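(* Let $n\ge 1$ be an integer and let $a_1,\dots,a_{n+1}>0$ be real numbers with $\sum_{i=1}^{n+1}a_i^2=1$. Let $$T^{n+1}=\{(z_1,\dots,z_{n+1})\in C^{n+1}: |z_i|=a_i \text{ for } i=1,\dots,n+1\}\subset S^{2n+1},$$ and let $T_C^n=T^{n+1}/S^1\subset CP^n$ be the quotient of $T^{n+1}$ by the $S^1$ action, i.e. its image under the Hopf map $S^{2n+1}\to CP^n$. Then $T_C^n$ is biharmonic in $CP^n$ if and only if, for every $i=1,\dots,n+1$, $$a_i d-\frac{1}{a_i^3}=2(n+3)\left((n+1)a_i-\frac{1}{a_i}\right),$$ where $d=\sum_{j=1}^{n+1}\frac{1}{a_j^2}$.
   Context: $S^{2n+1}$ is the unit sphere in $C^{n+1}$. The Hopf map $\pi:S^{2n+1}\to CP^n$ is the quotient by the diagonal action of the unit circle $S^1\subset C$; $CP^n$ carries the metric making $\pi$ a Riemannian submersion (the Fubini–Study metric of constant holomorphic sectional curvature $4$). For a smooth map $\phi:(M,g)\to(N,h)$ of Riemannian manifolds, the tension field is $\tau(\phi)=\mathrm{trace}\,\nabla d\phi$. The map $\phi$ is biharmonic if it is a critical point of the bienergy $E_2(\phi)=\frac12\int_M|\tau(\phi)|^2 v_g$, equivalently if the bitension field $$\tau_2(\phi)=-\Delta^\phi\tau(\phi)-\mathrm{trace}\,R^N(d\phi,\tau(\phi))d\phi$$ vanishes, where $\Delta^\phi=-\mathrm{trace}\,(\nabla^\phi)^2$ is the rough Laplacian on sections of $\phi^{-1}TN$ and $R^N(X,Y)=[\nabla_X,\nabla_Y]-\nabla_{[X,Y]}$.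 A submanifold, with the induced metric, is called biharmonic if its inclusion map is biharmonic (minimal submanifolds are biharmonic). *)

theory Defs
  imports "HOL-Analysis.Analysis" "HOL-Combinatorics.Transposition"
begin

primrec Ck_on :: "nat \<Rightarrow> ('a::euclidean_space \<Rightarrow> 'b::euclidean_space) \<Rightarrow> 'a set \<Rightarrow> bool" where
  "Ck_on 0 f S \<longleftrightarrow> continuous_on S f"
| "Ck_on (Suc k) f S \<longleftrightarrow>
     (\<forall>x\<in>S. f differentiable (at x)) \<and> (\<forall>v. Ck_on k (\<lambda>x. frechet_derivative f (at x) v) S)"

definition smooth_on :: "('a::euclidean_space \<Rightarrow> 'b::euclidean_space) \<Rightarrow> 'a set \<Rightarrow> bool" where
  "smooth_on f S \<longleftrightarrow> (\<forall>k. Ck_on k f S)"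

text \<open>A metric is given by its coordinate expression: g x u v is the inner product of the
  tangent vectors u and v at the point with coordinates x.\<close>

type_synonym 'v metric_coords = "'v \<Rightarrow> 'v \<Rightarrow> 'v \<Rightarrow> real"

definition metric_dual :: "'v::euclidean_space metric_coords \<Rightarrow> 'v \<Rightarrow> ('v \<Rightarrow> real) \<Rightarrow> 'v" where
  "metric_dual g x L = (THE v. \<forall>w. g x v w = L w)"

text \<open>The Levi-Civita connection on constant coordinate vector fields u, v (Koszul formula).\<close>

definition christoffel :: "'v::euclidean_space metric_coords \<Rightarrow> 'v \<Rightarrow> 'v \<Rightarrow> 'v \<Rightarrow> 'v" where
  "christoffel g x u v = metric_dual g x (\<lambda>w.
     (frechet_derivative (\<lambda>y. g y v w) (at x) u
      + frechet_derivative (\<lambda>y. g y u w) (at x) v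
      - frechet_derivative (\<lambda>y. g y u v) (at x) w) / 2)"

text \<open>Trace of a bilinear form with respect to g: the vectors b and
  metric_dual g x (inner b) form a pair of g-dual bases when b runs through Basis, so this is the
  sum of \<beta> e e over any g-orthonormal basis.\<close>

definition metric_trace ::
  "'u::euclidean_space metric_coords \<Rightarrow> 'u \<Rightarrow> ('u \<Rightarrow> 'u \<Rightarrow> 'b::real_vector) \<Rightarrow> 'b" where
  "metric_trace g x \<beta> = (\<Sum>b\<in>Basis. \<beta> b (metric_dual g x (\<lambda>w. b \<bullet> w)))"

text \<open>In the following, f is the coordinate expression of a map into a manifold with metric h,
  and V is the coordinate expression of a section of the pull-back of the tangent bundle along f.
  The first definition is the pull-back connection, in direction \<xi>.\<close>

definition pullback_conn ::
  "'v::euclidean_space metric_coords \<Rightarrow> ('u::euclidean_space \<Rightarrow> 'v) \<Rightarrow> ('u \<Rightarrow> 'v) \<Rightarrow> 'u \<Rightarrow> 'u \<Rightarrow> 'v" where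
  "pullback_conn h f V x \<xi> =
     frechet_derivative V (at x) \<xi> + christoffel h (f x) (frechet_derivative f (at x) \<xi>) (V x)"

definition second_fundamental_form ::
  "'u::euclidean_space metric_coords \<Rightarrow> 'v::euclidean_space metric_coords \<Rightarrow> ('u \<Rightarrow> 'v)
    \<Rightarrow> 'u \<Rightarrow> 'u \<Rightarrow> 'u \<Rightarrow> 'v" where
  "second_fundamental_form g h f x \<xi> \<eta> =
     pullback_conn h f (\<lambda>y. frechet_derivative f (at y) \<eta>) x \<xi>
     - frechet_derivative f (at x) (christoffel g x \<xi> \<eta>)"

definition tension_field ::
  "'u::euclidean_space metric_coords \<Rightarrow> 'v::euclidean_space metric_coords \<Rightarrow> ('u \<Rightarrow> 'v)
    \<Rightarrow> 'u \<Rightarrow> 'v" where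
  "tension_field g h f x = metric_trace g x (second_fundamental_form g h f x)"

definition second_covariant_derivative ::
  "'u::euclidean_space metric_coords \<Rightarrow> 'v::euclidean_space metric_coords \<Rightarrow> ('u \<Rightarrow> 'v)
    \<Rightarrow> ('u \<Rightarrow> 'v) \<Rightarrow> 'u \<Rightarrow> 'u \<Rightarrow> 'u \<Rightarrow> 'v" where
  "second_covariant_derivative g h f V x \<xi> \<eta> =
     pullback_conn h f (\<lambda>y. pullback_conn h f V y \<eta>) x \<xi>
     - pullback_conn h f V x (christoffel g x \<xi> \<eta>)"

definition rough_laplacian ::
  "'u::euclidean_space metric_coords \<Rightarrow> 'v::euclidean_space metric_coords \<Rightarrow> ('u \<Rightarrow> 'v)
    \<Rightarrow> ('u \<Rightarrow> 'v) \<Rightarrow> 'u \<Rightarrow> 'v" where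
  "rough_laplacian g h f V x = - metric_trace g x (second_covariant_derivative g h f V x)"

text \<open>The operator of covariant differentiation of a vector field Z in direction of a vector at a
  point is the case f = identity of the pull-back connection.  The curvature tensor R(X,Y)Z is
  computed on constant coordinate fields, for which the bracket [X,Y] vanishes.\<close>

definition curvature_tensor ::
  "'v::euclidean_space metric_coords \<Rightarrow> 'v \<Rightarrow> 'v \<Rightarrow> 'v \<Rightarrow> 'v \<Rightarrow> 'v" where
  "curvature_tensor h p X Y Z =
     pullback_conn h (\<lambda>q. q) (\<lambda>q. pullback_conn h (\<lambda>q. q) (\<lambda>q. Z) q Y) p X
     - pullback_conn h (\<lambda>q. q) (\<lambda>q. pullback_conn h (\<lambda>q. q) (\<lambda>q. Z) q X) p Y"

definition bitension_field ::
  "'u::euclidean_space metric_coords \<Rightarrow> 'v::euclidean_space metric_coords \<Rightarrow> ('u \<Rightarrow> 'v)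
    \<Rightarrow> 'u \<Rightarrow> 'v" where
  "bitension_field g h f x =
     - rough_laplacian g h f (tension_field g h f) x
     - metric_trace g x (\<lambda>\<xi> \<eta>. curvature_tensor h (f x)
         (frechet_derivative f (at x) \<xi>) (tension_field g h f x) (frechet_derivative f (at x) \<eta>))"

text \<open>A Riemannian manifold is represented by an atlas: a set of triples (U, x, g) where x is an
  injective parametrization, defined on the open set U, of an open part of the manifold, and g is
  the coordinate expression of the metric on U.  Values of x and g off U are irrelevant.\<close>

type_synonym ('v, 'p) riem_manifold = "('v set \<times> ('v \<Rightarrow> 'p) \<times> 'v metric_coords) set"

definition points :: "('v, 'p) riem_manifold \<Rightarrow> 'p set" where
  "points M = (\<Union>(U, x, g)\<in>M. x ` U)"

definition manifold_open :: "('v::euclidean_space, 'p) riem_manifold \<Rightarrow> 'p set \<Rightarrow> bool" where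
  "manifold_open M W \<longleftrightarrow> W \<subseteq> points M \<and> (\<forall>(U, x, g)\<in>M. open {u\<in>U. x u \<in> W})"

text \<open>The coordinate expression of \<phi> with respect to the parametrizations x (on U) and y (on V),
  and its domain.\<close>

definition coord_dom :: "'u set \<Rightarrow> ('u \<Rightarrow> 'p) \<Rightarrow> ('p \<Rightarrow> 'q) \<Rightarrow> 'v set \<Rightarrow> ('v \<Rightarrow> 'q) \<Rightarrow> 'u set" where
  "coord_dom U x \<phi> V y = {u\<in>U. \<phi> (x u) \<in> y ` V}"

definition coord_map :: "('u \<Rightarrow> 'p) \<Rightarrow> ('p \<Rightarrow> 'q) \<Rightarrow> 'v set \<Rightarrow> ('v \<Rightarrow> 'q) \<Rightarrow> 'u \<Rightarrow> 'v" where
  "coord_map x \<phi> V y = (\<lambda>u. the_inv_into V y (\<phi> (x u)))"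

definition smooth_map ::
  "('u::euclidean_space, 'p) riem_manifold \<Rightarrow> ('v::euclidean_space, 'q) riem_manifold
    \<Rightarrow> ('p \<Rightarrow> 'q) \<Rightarrow> bool" where
  "smooth_map M N \<phi> \<longleftrightarrow> \<phi> ` points M \<subseteq> points N \<and>
     (\<forall>(U, x, g)\<in>M. \<forall>(V, y, h)\<in>N.
        open (coord_dom U x \<phi> V y) \<and> smooth_on (coord_map x \<phi> V y) (coord_dom U x \<phi> V y))"

definition isometric_immersion ::
  "('u::euclidean_space, 'p) riem_manifold \<Rightarrow> ('v::euclidean_space, 'q) riem_manifold
    \<Rightarrow> ('p \<Rightarrow> 'q) \<Rightarrow> bool" where
  "isometric_immersion M N \<phi> \<longleftrightarrow> smooth_map M N \<phi> \<and>
     (\<forall>(U, x, g)\<in>M. \<forall>(V, y, h)\<in>N. \<forall>u\<in>coord_dom U x \<phi> V y.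
        let F = coord_map x \<phi> V y; dF = frechet_derivative F (at u)
        in inj dF \<and> (\<forall>\<xi> \<eta>. g u \<xi> \<eta> = h (F u) (dF \<xi>) (dF \<eta>)))"

definition biharmonic_map ::
  "('u::euclidean_space, 'p) riem_manifold \<Rightarrow> ('v::euclidean_space, 'q) riem_manifold
    \<Rightarrow> ('p \<Rightarrow> 'q) \<Rightarrow> bool" where
  "biharmonic_map M N \<phi> \<longleftrightarrow> smooth_map M N \<phi> \<and>
     (\<forall>(U, x, g)\<in>M. \<forall>(V, y, h)\<in>N. \<forall>u\<in>coord_dom U x \<phi> V y.
        bitension_field g h (coord_map x \<phi> V y) u = 0)"

text \<open>The submanifold structure of S: all smooth immersive parametrizations of relatively open
  parts of S that are homeomorphisms onto their image, each with the induced metric.\<close>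

definition submanifold ::
  "('v::euclidean_space, 'p) riem_manifold \<Rightarrow> 'p set \<Rightarrow> ('u::euclidean_space, 'p) riem_manifold" where
  "submanifold N S = {(U, x, g). open U \<and> inj_on x U \<and> x ` U \<subseteq> S \<and>
     isometric_immersion {(U, \<lambda>u. u, g)} N x \<and>
     (\<forall>W. open W \<and> W \<subseteq> U \<longrightarrow> (\<exists>G. manifold_open N G \<and> x ` W = S \<inter> G))}"

text \<open>The type argument fixes the dimension of the submanifold.  The condition on points says
  that S really is an embedded submanifold of this dimension.\<close>

definition biharmonic_submanifold ::
  "'u::euclidean_space itself \<Rightarrow> ('v::euclidean_space, 'p) riem_manifold \<Rightarrow> 'p set \<Rightarrow> bool" where
  "biharmonic_submanifold _ N S \<longleftrightarrow>
     points (submanifold N S :: ('u, 'p) riem_manifold) = S \<and>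
     biharmonic_map (submanifold N S :: ('u, 'p) riem_manifold) N (\<lambda>p. p)"

text \<open>For n = CARD('n), the n + 1 homogeneous coordinates are indexed by 'n option.\<close>

definition hopf :: "complex ^ 'k \<Rightarrow> (complex ^ 'k) set" where
  "hopf z = {c *s z |c. cmod c = 1}"

text \<open>The affine chart around the points with nonvanishing coordinate k: the coordinate k is set
  to 1 and the affine coordinates are distributed over the other positions.\<close>

definition affine_lift :: "'n option \<Rightarrow> complex ^ 'n \<Rightarrow> complex ^ ('n::finite option)" where
  "affine_lift k w = (\<chi> i. case Transposition.transpose None k i of None \<Rightarrow> 1 | Some j \<Rightarrow> w $ j)"

definition sphere_lift :: "'n option \<Rightarrow> complex ^ 'n \<Rightarrow> complex ^ ('n::finite option)" where
  "sphere_lift k w = affine_lift k w /\<^sub>R norm (affine_lift k w)"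

text \<open>Orthogonal projection of a tangent vector of the sphere at z to the complement of the
  Hopf fibre, whose tangent space is spanned by the unit vector \<i> *s z.\<close>

definition horizontal_part :: "complex ^ 'k \<Rightarrow> complex ^ 'k \<Rightarrow> complex ^ ('k::finite)" where
  "horizontal_part z \<xi> = \<xi> - (\<xi> \<bullet> (\<i> *s z)) *\<^sub>R (\<i> *s z)"

text \<open>Since sphere_lift k is a section of the Hopf map over the affine chart, the horizontal part
  of its derivative in direction u is the horizontal lift of u.  The metric for which the Hopf map
  is a Riemannian submersion is therefore the following one.\<close>

definition fubini_study_coords :: "'n::finite option \<Rightarrow> (complex ^ 'n) metric_coords" where
  "fubini_study_coords k w u v =
     (let z = sphere_lift k w; D = frechet_derivative (sphere_lift k) (at w)
      in horizontal_part z (D u) \<bullet> horizontal_part z (D v))"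

definition complex_projective_space ::
  "(complex ^ 'n, (complex ^ ('n::finite option)) set) riem_manifold" where
  "complex_projective_space =
     range (\<lambda>k. (UNIV, \<lambda>w. hopf (sphere_lift k w), fubini_study_coords k))"

definition torus :: "('k \<Rightarrow> real) \<Rightarrow> (complex ^ 'k) set" where
  "torus a = {z. \<forall>i. cmod (z $ i) = a i}"

text \<open>The affine coordinates of a point of the sphere; the remaining lemmas confirm that the
  above atlas covers the image of the sphere under the Hopf map, and that the Hopf map is a
  Riemannian submersion, i.e. isometric on vectors that are orthogonal to z and \<i> *s z.\<close>

definition affine_coords :: "'n option \<Rightarrow> complex ^ ('n::finite option) \<Rightarrow> complex ^ 'n" where
  "affine_coords k z = (\<chi> j. z $ Transposition.transpose None k (Some j) / z $ k)"

lemma affine_lift_coords: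
  assumes "z $ k \<noteq> 0"
  shows "affine_lift k (affine_coords k z) = inverse (z $ k) *s z"
proof -
  have "affine_lift k (affine_coords k z) $ i = (inverse (z $ k) *s z) $ i" for i
  proof (cases "Transposition.transpose None k i")
    case None
    then have "i = k"
      by (metis transpose_apply_first transpose_eq_iff transpose_involutory)
    then show ?thesis
      using assms None by (simp add: affine_lift_def)
  next
    case (Some j)
    then have "Transposition.transpose None k (Some j) = i"
      by (metis transpose_involutory)
    then show ?thesis
      using Some by (simp add: affine_lift_def affine_coords_def divide_inverse)
  qed
  then show ?thesis
    by (simp add: vec_eq_iff)
qed

lemma norm_vector_scalar_mult: "norm (c *s z) = cmod c * norm (z :: complex ^ 'k::finite)"
  by (simp add: norm_vec_def norm_mult L2_set_right_distrib)

lemma sphere_lift_coords: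
  assumes "z $ k \<noteq> 0"
  shows "sphere_lift k (affine_coords k z) = (cmod (z $ k) / z $ k) *s (z /\<^sub>R norm z)"
proof -
  have "norm (inverse (z $ k) *s z) = norm z / cmod (z $ k)"
    by (simp add: norm_vector_scalar_mult norm_inverse divide_inverse)
  then show ?thesis
    using assms
    by (simp add: sphere_lift_def affine_lift_coords vec_eq_iff)
       (simp add: scaleR_conv_of_real field_simps)
qed

lemma norm_sphere_lift: "norm (sphere_lift k w) = 1"
proof -
  have "affine_lift k w $ k = 1"
    by (simp add: affine_lift_def)
  then have "affine_lift k w \<noteq> 0"
    by auto
  then show ?thesis
    by (simp add: sphere_lift_def)
qed

lemma points_complex_projective_space:
  "points complex_projective_space = hopf ` (sphere 0 1 :: (complex ^ ('n::finite option)) set)"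
proof (intro equalityI subsetI)
  fix p :: "(complex ^ ('n option)) set"
  assume "p \<in> points complex_projective_space"
  then show "p \<in> hopf ` sphere 0 1"
    by (auto simp: points_def complex_projective_space_def norm_sphere_lift)
next
  fix p :: "(complex ^ ('n option)) set"
  assume "p \<in> hopf ` sphere 0 1"
  then obtain z where z: "norm z = 1" "p = hopf z"
    by auto
  then have "z \<noteq> 0"
    by auto
  then obtain k where k: "z $ k \<noteq> 0"
    by (auto simp: vec_eq_iff)
  define c where "c = cmod (z $ k) / z $ k"
  have c: "cmod c = 1"
    using k by (simp add: c_def norm_divide)
  have "hopf (c *s z) = hopf z"
  proof -
    have "\<exists>b'. b *s z = b' *s (c *s z) \<and> cmod b' = 1" if "cmod b = 1" for b
      using that c by (intro exI[of _ "b / c"]) (auto simp: vector_smult_assoc norm_divide)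
    moreover have "\<exists>b'. b *s (c *s z) = b' *s z \<and> cmod b' = 1" if "cmod b = 1" for b
      using that c by (intro exI[of _ "b * c"]) (auto simp: vector_smult_assoc norm_mult)
    ultimately show ?thesis
      unfolding hopf_def by blast
  qed
  then have "p = hopf (sphere_lift k (affine_coords k z))"
    using z k by (simp add: sphere_lift_coords c_def)
  then show "p \<in> points complex_projective_space"
    by (auto simp: points_def complex_projective_space_def)
qed

lemma inner_vector_scalar_mult:
  "(c *s x) \<bullet> (c *s y) = (cmod c)\<^sup>2 * (x \<bullet> (y :: complex ^ 'k::finite))"
proof -
  have "inner (c * u) (c * v) = (cmod c)\<^sup>2 * inner u v" for u v
    unfolding inner_complex_def cmod_power2 by (simp add: power2_eq_square algebra_simps)
  then show ?thesis
    by (simp add: inner_vec_def sum_distrib_left)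
qed

lemma bounded_bilinear_vector_scalar_mult:
  "bounded_bilinear ((*s) :: complex \<Rightarrow> complex ^ 'k::finite \<Rightarrow> complex ^ 'k)"
  by (rule bounded_bilinear.intro)
     (auto simp: vec_eq_iff algebra_simps norm_vector_scalar_mult intro: exI[of _ 1])

lemma sphere_lift_differentiable:
  "sphere_lift (k :: 'n::finite option) differentiable (at w)"
proof -
  let ?L = "\<lambda>w. affine_lift k w - affine_lift k 0"
  have "linear ?L"
    by (rule linearI) (auto simp: affine_lift_def vec_eq_iff split: option.split)
  then have "?L differentiable (at w)"
    by (rule linear_imp_differentiable)
  then have "(\<lambda>w. ?L w + affine_lift k 0) differentiable (at w)"
    by (intro differentiable_add differentiable_const)
  then have A: "affine_lift k differentiable (at w)"
    by simp
  have nz: "affine_lift k w \<noteq> 0"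
    using norm_sphere_lift[of k w] by (auto simp: sphere_lift_def)
  have "(\<lambda>w. norm (affine_lift k w)) differentiable (at w)"
    using differentiable_compose[OF differentiable_norm_at[OF nz] A] .
  then have "(\<lambda>w. inverse (norm (affine_lift k w)) *\<^sub>R affine_lift k w) differentiable (at w)"
    using A nz by (intro differentiable_scaleR differentiable_inverse) auto
  then show ?thesis
    by (simp add: sphere_lift_def[abs_def])
qed

lemma hopf_riemannian_submersion:
  fixes z X Y :: "complex ^ ('n::finite option)"
  assumes z: "norm z = 1" "z $ k \<noteq> 0"
    and X: "X \<bullet> z = 0" "X \<bullet> (\<i> *s z) = 0"
    and Y: "Y \<bullet> z = 0" "Y \<bullet> (\<i> *s z) = 0"
    and q: "(affine_coords k has_derivative q) (at z)"
  shows "fubini_study_coords k (affine_coords k z) (q X) (q Y) = X \<bullet> Y"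
proof -
  define D where "D = frechet_derivative (sphere_lift k) (at (affine_coords k z))"
  define p where "p = (\<lambda>y::complex ^ ('n option). cmod (y $ k) / y $ k)"
  have D: "(sphere_lift k has_derivative D) (at (affine_coords k z))"
    unfolding D_def using sphere_lift_differentiable frechet_derivative_works by blast
  have C: "((\<lambda>y. sphere_lift k (affine_coords k y)) has_derivative (\<lambda>X. D (q X))) (at z)"
    using has_derivative_compose[OF q D] .
  have nz: "z \<noteq> 0"
    using z by auto
  have comp: "((\<lambda>y. y $ k) has_derivative (\<lambda>h. h $ k)) (at z)"
    by (rule bounded_linear_imp_has_derivative[OF bounded_linear_vec_nth])
  have "(\<lambda>y. cmod (y $ k)) differentiable (at z)"
    using differentiable_compose[OF differentiable_norm_at[OF z(2)] differentiableI[OF comp]] .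
  then obtain m where "((\<lambda>y. cmod (y $ k)) has_derivative m) (at z)"
    by (auto simp: differentiable_def)
  then have "((\<lambda>y. complex_of_real (cmod (y $ k))) has_derivative (\<lambda>h. complex_of_real (m h))) (at z)"
    by (rule has_derivative_of_real)
  from has_derivative_divide[OF this comp z(2)]
  obtain p' where p': "(p has_derivative p') (at z)"
    unfolding p_def by blast
  have n: "((\<lambda>y. inverse (norm y) *\<^sub>R y) has_derivative (\<lambda>h. h - (h \<bullet> z) *\<^sub>R z)) (at z)"
  proof -
    have "(norm has_derivative (\<lambda>h. h \<bullet> z)) (at z)"
      using has_derivative_norm[OF nz] z(1) by (simp add: sgn_div_norm inner_commute)
    then show ?thesis
      using nz z(1) by (auto intro!: derivative_eq_intros)
  qed
  have G: "((\<lambda>y. p y *s (inverse (norm y) *\<^sub>R y)) has_derivative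
      (\<lambda>h. p z *s (h - (h \<bullet> z) *\<^sub>R z) + p' h *s z)) (at z)"
    using bounded_bilinear.FDERIV[OF bounded_bilinear_vector_scalar_mult p' n] z by simp
  have op: "open {y :: complex ^ ('n option). y $ k \<noteq> 0}"
    by (intro open_Collect_neq continuous_intros)
  have C': "((\<lambda>y. sphere_lift k (affine_coords k y)) has_derivative
      (\<lambda>h. p z *s (h - (h \<bullet> z) *\<^sub>R z) + p' h *s z)) (at z)"
    by (rule has_derivative_transform_within_open[OF G op])
       (use z in \<open>auto simp: sphere_lift_coords p_def\<close>)
  have E: "D (q h) = p z *s h + p' h *s z" if "h \<bullet> z = 0" for h
    using fun_cong[OF has_derivative_unique[OF C C'], of h] that by simp
  have lift: "sphere_lift k (affine_coords k z) = p z *s z"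
    using z by (simp add: sphere_lift_coords p_def)
  have p1: "cmod (p z) = 1"
    using z by (simp add: p_def norm_divide)
  have unit: "(p z *s x) \<bullet> (p z *s y) = x \<bullet> y" for x y :: "complex ^ ('n option)"
    using p1 by (simp add: inner_vector_scalar_mult)
  have H: "horizontal_part (p z *s z) (D (q h)) = p z *s h"
    if h: "h \<bullet> z = 0" "h \<bullet> (\<i> *s z) = 0" for h
  proof -
    define V where "V = \<i> *s (p z *s z)"
    define r where "r = Im (p' h * cnj (p z))"
    have "((\<lambda>y. sphere_lift k (affine_coords k y) \<bullet> sphere_lift k (affine_coords k y))
        has_derivative (\<lambda>h. (p z *s z) \<bullet> D (q h) + D (q h) \<bullet> (p z *s z))) (at z)"
      using has_derivative_inner[OF C C] by (simp add: lift)
    moreover have "(\<lambda>y. sphere_lift k (affine_coords k y) \<bullet> sphere_lift k (affine_coords k y)) = (\<lambda>_. 1)"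
      using norm_sphere_lift[of k] by (simp add: dot_square_norm fun_eq_iff)
    ultimately have "((\<lambda>_. 1 :: real) has_derivative
        (\<lambda>h. (p z *s z) \<bullet> D (q h) + D (q h) \<bullet> (p z *s z))) (at z)"
      by simp
    from fun_cong[OF has_derivative_unique[OF this has_derivative_const], of h]
    have "D (q h) \<bullet> (p z *s z) = 0"
      by (simp add: inner_commute)
    moreover have "(p' h *s z) \<bullet> (p z *s z) = Re (p' h * cnj (p z)) * (z \<bullet> z) + r * ((\<i> *s z) \<bullet> z)"
      unfolding inner_vec_def r_def sum_distrib_left sum.distrib[symmetric]
      by (rule sum.cong) (auto simp: inner_complex_def algebra_simps)
    moreover have "(\<i> *s z) \<bullet> z = 0"
      by (simp add: inner_vec_def inner_complex_def algebra_simps)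
    ultimately have "Re (p' h * cnj (p z)) = 0"
      using h z unit[of h z] by (simp add: E inner_add_left dot_square_norm)
    then have c: "p' h * cnj (p z) = \<i> * r"
      by (simp add: r_def complex_eq_iff)
    have "p z * cnj (p z) = 1"
      using p1 by (metis complex_norm_square of_real_1 one_power2)
    then have "p' h = \<i> * r * p z"
      using c by (metis (no_types, lifting) mult.assoc mult.commute mult.right_neutral)
    then have pz: "p' h *s z = r *\<^sub>R V"
      by (simp add: V_def vec_eq_iff) (simp add: scaleR_conv_of_real)
    have V: "V = p z *s (\<i> *s z)"
      by (simp add: V_def vec_eq_iff)
    have "(\<i> *s z) \<bullet> (\<i> *s z) = 1"
      using z by (simp add: dot_square_norm norm_vector_scalar_mult)
    then have "V \<bullet> V = 1" "(p z *s h) \<bullet> V = 0"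
      using h unfolding V unit by auto
    then show ?thesis
      unfolding horizontal_part_def E[OF h(1)] pz V_def[symmetric]
      by (simp add: inner_add_left)
  qed
  show ?thesis
    by (simp add: fubini_study_coords_def lift flip: D_def) (simp add: H X Y unit)
qed

end

theory Submission
  imports Defs
begin

text \<open>In an affine chart with index \<open>k\<close> the quotient of the torus becomes the product of the circles
\<open>\<bar>w\<^sub>j\<bar> = r\<^sub>j\<close>, and \<open>1 + \<Sum>r\<^sub>j\<^sup>2 = 1 / a\<^sub>k\<^sup>2\<close>.  A coordinate expression \<open>F\<close> of a parametrization of a piece
of it has \<open>dF(\<xi>)\<^sub>j = \<i> \<omega>\<^sub>j(\<xi>) F\<^sub>j\<close> with real one-forms \<open>\<omega>\<^sub>j\<close>, the differentials of the angles.  With the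
weights \<open>p\<^sub>j = r\<^sub>j\<^sup>2 / (1 + \<Sum>r\<^sub>i\<^sup>2)\<close>, which are the other \<open>a\<^sub>i\<^sup>2\<close>, and \<open>p\<^sub>0 = a\<^sub>k\<^sup>2\<close>, the induced metric is
the covariance form \<open>\<Sum> p\<^sub>j s\<^sub>j t\<^sub>j - (\<Sum> p\<^sub>j s\<^sub>j) (\<Sum> p\<^sub>j t\<^sub>j)\<close> in \<open>s = \<omega>(\<xi>)\<close>, \<open>t = \<omega>(\<eta>)\<close>.  It is flat, and all the
tensors involved have constant coefficients in the fields \<open>c s\<^sub>j F\<^sub>j\<close>, where \<open>c\<close> is complex and \<open>s\<close> is real:
covariant differentiation of such a field adds \<open>\<i> B(\<omega>(\<xi>), s)\<close> to the derivative of \<open>s\<close>, where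
\<open>B(s, t) = s t - (p \<bullet> s) t - (p \<bullet> t) s\<close>.  Hence the tension field is \<open>- t\<^sub>j F\<^sub>j\<close> with the constants
\<open>t\<^sub>j = 1 / p\<^sub>j - 1 / p\<^sub>0\<close>, the trace of \<open>B\<close>.  The bitension field is given by the trace of
\<open>B(\<cdot>, B(\<cdot>, t))\<close> minus the curvature term \<open>(n + 3) t\<close>; its coefficients are
\<open>(1 / p\<^sub>j - 1 / p\<^sub>0) (1 / p\<^sub>j + 1 / p\<^sub>0 - 2 (n + 3))\<close> (lemma \<open>bitension_field_along\<close>).

So the torus is biharmonic if and only if \<open>X\<^sub>i\<^sup>2 - 2 (n + 3) X\<^sub>i\<close>, where \<open>X\<^sub>i = 1 / a\<^sub>i\<^sup>2\<close>, is independent of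
\<open>i\<close>.  The average of these numbers with the weights \<open>a\<^sub>i\<^sup>2\<close> is \<open>d - 2 (n + 3) (n + 1)\<close>, so this must be
their common value; multiplied by \<open>a\<^sub>i\<close> this is the stated equation (lemma \<open>torus_condition_iff\<close>).

The definition of a biharmonic submanifold involves all parametrizations and all pairs of charts.  The
computation is therefore carried out with the forms \<open>\<omega>\<close> of an arbitrary parametrization.  They are
independent because it is an immersion and closed because second derivatives are symmetric, and this
identifies the Christoffel symbols of the induced metric with the derivative of \<open>\<omega>\<close>.  It remains to see that the torus is
an embedded submanifold, and this is shown by the parametrizations by angles
(lemma \<open>torus_param_submanifold\<close>).\<close>

section \<open>Symmetry of second derivatives\<close>

text \<open>The mean value theorem, applied first in direction \<open>u\<close> to the difference in direction \<open>v\<close> and then in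
direction \<open>v\<close>.  The value of the second difference does not change when \<open>u\<close> and \<open>v\<close> are exchanged, which is
the reason for the symmetry of second derivatives.\<close>

lemma mixed_difference_mean_value:
  fixes f :: "'a::real_normed_vector \<Rightarrow> real"
  assumes h: "h > 0"
    and box: "\<And>s t. 0 \<le> s \<Longrightarrow> s \<le> h \<Longrightarrow> 0 \<le> t \<Longrightarrow> t \<le> h \<Longrightarrow> x + s *\<^sub>R u + t *\<^sub>R v \<in> S"
    and f: "\<And>y. y \<in> S \<Longrightarrow> (f has_derivative f' y) (at y)"
    and g: "\<And>y. y \<in> S \<Longrightarrow> ((\<lambda>y. f' y u) has_derivative f2 y) (at y)"
  obtains s t where "0 < s" "s < h" "0 < t" "t < h"
    "f (x + h *\<^sub>R u + h *\<^sub>R v) - f (x + h *\<^sub>R u) - f (x + h *\<^sub>R v) + f x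
      = h\<^sup>2 * f2 (x + s *\<^sub>R u + t *\<^sub>R v) v"
proof -
  define \<phi> where "\<phi> s = f (x + s *\<^sub>R u + h *\<^sub>R v) - f (x + s *\<^sub>R u + 0 *\<^sub>R v)" for s
  have along: "((\<lambda>s. f (x + s *\<^sub>R u + t *\<^sub>R v)) has_real_derivative f' (x + s *\<^sub>R u + t *\<^sub>R v) u) (at s)"
    if "0 \<le> s" "s \<le> h" "0 \<le> t" "t \<le> h" for s t
  proof -
    have "((\<lambda>s. x + s *\<^sub>R u + t *\<^sub>R v) has_derivative (\<lambda>s. s *\<^sub>R u)) (at s)"
      by (auto intro!: derivative_eq_intros)
    from has_derivative_compose[OF this f[OF box[OF that]]]
    show ?thesis
      unfolding has_field_derivative_def
      by (rule has_derivative_eq_rhs)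
        (simp add: fun_eq_iff linear_simps[OF has_derivative_bounded_linear[OF f[OF box[OF that]]]] mult.commute)
  qed
  have "\<exists>z>0. z < h \<and> \<phi> h - \<phi> 0 = (h - 0) * (f' (x + z *\<^sub>R u + h *\<^sub>R v) u - f' (x + z *\<^sub>R u + 0 *\<^sub>R v) u)"
    unfolding \<phi>_def by (rule MVT2[OF h]) (intro DERIV_diff along; use h in simp)
  then obtain s where s: "0 < s" "s < h"
    "\<phi> h - \<phi> 0 = h * (f' (x + s *\<^sub>R u + h *\<^sub>R v) u - f' (x + s *\<^sub>R u + 0 *\<^sub>R v) u)"
    by auto
  have across: "((\<lambda>t. f' (x + s *\<^sub>R u + t *\<^sub>R v) u) has_real_derivative f2 (x + s *\<^sub>R u + t *\<^sub>R v) v) (at t)"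
    if t: "0 \<le> t" "t \<le> h" for t
  proof -
    have mem: "x + s *\<^sub>R u + t *\<^sub>R v \<in> S" using s t by (intro box) auto
    have "((\<lambda>t. x + s *\<^sub>R u + t *\<^sub>R v) has_derivative (\<lambda>t. t *\<^sub>R v)) (at t)"
      by (auto intro!: derivative_eq_intros)
    from has_derivative_compose[OF this g[OF mem]]
    show ?thesis
      unfolding has_field_derivative_def
      by (rule has_derivative_eq_rhs)
        (simp add: fun_eq_iff linear_simps[OF has_derivative_bounded_linear[OF g[OF mem]]] mult.commute)
  qed
  have "\<exists>z>0. z < h \<and> f' (x + s *\<^sub>R u + h *\<^sub>R v) u - f' (x + s *\<^sub>R u + 0 *\<^sub>R v) u
      = (h - 0) * f2 (x + s *\<^sub>R u + z *\<^sub>R v) v"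
    by (rule MVT2[OF h]) (rule across)
  then obtain t where t: "0 < t" "t < h" "f' (x + s *\<^sub>R u + h *\<^sub>R v) u - f' (x + s *\<^sub>R u + 0 *\<^sub>R v) u
      = h * f2 (x + s *\<^sub>R u + t *\<^sub>R v) v"
    by auto
  show ?thesis
    using that[OF s(1,2) t(1,2)] s(3) t(3) by (simp add: \<phi>_def power2_eq_square algebra_simps)
qed

lemma symmetric_second_derivative_real:
  fixes f :: "'a::real_normed_vector \<Rightarrow> real"
  assumes S: "open S" "x \<in> S"
    and f: "\<And>y. y \<in> S \<Longrightarrow> (f has_derivative f' y) (at y)"
    and gu: "\<And>y. y \<in> S \<Longrightarrow> ((\<lambda>y. f' y u) has_derivative fu y) (at y)"
    and gv: "\<And>y. y \<in> S \<Longrightarrow> ((\<lambda>y. f' y v) has_derivative fv y) (at y)"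
    and cu: "continuous_on S (\<lambda>y. fu y v)" and cv: "continuous_on S (\<lambda>y. fv y u)"
  shows "fu x v = fv x u"
proof (rule ccontr)
  assume ne: "fu x v \<noteq> fv x u"
  define e where "e = \<bar>fu x v - fv x u\<bar> / 2"
  have e: "e > 0" using ne by (simp add: e_def)
  have iu: "isCont (\<lambda>y. fu y v) x" and iv: "isCont (\<lambda>y. fv y u) x"
    using cu cv S by (simp_all add: continuous_on_eq_continuous_at)
  obtain d1 where d1: "d1 > 0" "\<And>y. dist y x < d1 \<Longrightarrow> dist (fu y v) (fu x v) < e"
    using iu e unfolding continuous_at_eps_delta by (metis)
  obtain d2 where d2: "d2 > 0" "\<And>y. dist y x < d2 \<Longrightarrow> dist (fv y u) (fv x u) < e"
    using iv e unfolding continuous_at_eps_delta by (metis)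
  obtain d3 where d3: "d3 > 0" "ball x d3 \<subseteq> S"
    using S open_contains_ball by blast
  define d where "d = min d1 (min d2 d3)"
  \<comment> \<open>a step for which the whole square spanned by \<open>h u\<close> and \<open>h v\<close> stays within distance \<open>d\<close> of \<open>x\<close>\<close>
  define h where "h = d / (2 * (norm u + norm v + 1))"
  have d: "d > 0" using d1 d2 d3 by (simp add: d_def)
  have nn: "norm u + norm v + 1 > 0" by (smt (verit) norm_ge_zero)
  then have h: "h > 0" using d by (simp add: h_def)
  have small: "dist (x + s *\<^sub>R u + t *\<^sub>R v) x < d" if "0 \<le> s" "s \<le> h" "0 \<le> t" "t \<le> h" for s t
  proof -
    have "norm (s *\<^sub>R u + t *\<^sub>R v) \<le> h * norm u + h * norm v"
      using norm_triangle_ineq[of "s *\<^sub>R u" "t *\<^sub>R v"] that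
        mult_right_mono[of s h "norm u"] mult_right_mono[of t h "norm v"] by simp
    also have "\<dots> \<le> h * (norm u + norm v + 1)" using h by (simp add: algebra_simps)
    also have "\<dots> = d / 2"
    proof -
      have "d / (2 * N) * N = d / 2" if "N > 0" for N :: real
        using that by simp
      from this[OF nn] show ?thesis by (simp add: h_def)
    qed
    also have "\<dots> < d" using d by simp
    finally show ?thesis by (simp add: dist_norm add.assoc)
  qed
  have box: "x + s *\<^sub>R u + t *\<^sub>R v \<in> S" if "0 \<le> s" "s \<le> h" "0 \<le> t" "t \<le> h" for s t
    using small[OF that] d3 by (auto simp: d_def dist_commute)
  have box': "x + s *\<^sub>R v + t *\<^sub>R u \<in> S" if "0 \<le> s" "s \<le> h" "0 \<le> t" "t \<le> h" for s t
    using box[OF that(3,4,1,2)] by (simp add: algebra_simps)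
  obtain s t where st: "0 < s" "s < h" "0 < t" "t < h"
    "f (x + h *\<^sub>R u + h *\<^sub>R v) - f (x + h *\<^sub>R u) - f (x + h *\<^sub>R v) + f x
      = h\<^sup>2 * fu (x + s *\<^sub>R u + t *\<^sub>R v) v"
    by (rule mixed_difference_mean_value[OF h box f gu])
  obtain s' t' where st': "0 < s'" "s' < h" "0 < t'" "t' < h"
    "f (x + h *\<^sub>R v + h *\<^sub>R u) - f (x + h *\<^sub>R v) - f (x + h *\<^sub>R u) + f x
      = h\<^sup>2 * fv (x + s' *\<^sub>R v + t' *\<^sub>R u) u"
    by (rule mixed_difference_mean_value[OF h box' f gv])
  have "f (x + h *\<^sub>R v + h *\<^sub>R u) = f (x + h *\<^sub>R u + h *\<^sub>R v)"
    by (simp add: algebra_simps)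
  then have "h\<^sup>2 * fu (x + s *\<^sub>R u + t *\<^sub>R v) v = h\<^sup>2 * fv (x + s' *\<^sub>R v + t' *\<^sub>R u) u"
    using st(5) st'(5) by linarith
  then have "fu (x + s *\<^sub>R u + t *\<^sub>R v) v = fv (x + t' *\<^sub>R u + s' *\<^sub>R v) u"
    using h by (simp add: algebra_simps)
  moreover have "\<bar>fu x v - fv x u\<bar> = 2 * e" by (simp add: e_def)
  moreover have "dist (fu (x + s *\<^sub>R u + t *\<^sub>R v) v) (fu x v) < e"
    using small[of s t] st by (intro d1) (auto simp: d_def)
  moreover have "dist (fv (x + t' *\<^sub>R u + s' *\<^sub>R v) u) (fv x u) < e"
    using small[of t' s'] st' by (intro d2) (auto simp: d_def)
  ultimately show False unfolding dist_real_def by linarith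
qed

lemma differentiable_has_frechet_derivative:
  "f differentiable (at x) \<Longrightarrow> (f has_derivative frechet_derivative f (at x)) (at x)"
  by (simp add: frechet_derivative_works)

lemma frechet_derivative_eqI:
  "(f has_derivative f') (at x) \<Longrightarrow> frechet_derivative f (at x) v = f' v"
  using frechet_derivative_at by metis

lemma Ck_on_2_symmetric:
  fixes F :: "'a::euclidean_space \<Rightarrow> 'b::euclidean_space"
  assumes C: "Ck_on 2 F S" and S: "open S" "x \<in> S"
  shows "frechet_derivative (\<lambda>y. frechet_derivative F (at y) u) (at x) v
       = frechet_derivative (\<lambda>y. frechet_derivative F (at y) v) (at x) u"
proof (rule euclidean_eqI)
  fix b :: 'b
  have C: "\<And>y. y \<in> S \<Longrightarrow> F differentiable (at y)"
    "\<And>y u. y \<in> S \<Longrightarrow> (\<lambda>y. frechet_derivative F (at y) u) differentiable (at y)"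
    "\<And>u v. continuous_on S (\<lambda>y. frechet_derivative (\<lambda>y. frechet_derivative F (at y) u) (at y) v)"
    using C by (auto simp: numeral_2_eq_2)
  show "frechet_derivative (\<lambda>y. frechet_derivative F (at y) u) (at x) v \<bullet> b
       = frechet_derivative (\<lambda>y. frechet_derivative F (at y) v) (at x) u \<bullet> b"
    by (rule symmetric_second_derivative_real[OF S, where f = "\<lambda>y. F y \<bullet> b"
          and f' = "\<lambda>y w. frechet_derivative F (at y) w \<bullet> b"
          and fu = "\<lambda>y w. frechet_derivative (\<lambda>y. frechet_derivative F (at y) u) (at y) w \<bullet> b"
          and fv = "\<lambda>y w. frechet_derivative (\<lambda>y. frechet_derivative F (at y) v) (at y) w \<bullet> b"])
      (auto intro!: has_derivative_inner_left differentiable_has_frechet_derivative C continuous_intros)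
qed

section \<open>The Fubini-Study metric in affine coordinates and its connection\<close>

abbreviation imult :: "complex ^ 'k \<Rightarrow> complex ^ 'k"
  where "imult v \<equiv> \<i> *s v"

lemma imult_simps:
  fixes u v :: "complex ^ ('k::finite)"
  shows "imult (u + v) = imult u + imult v" "imult (u - v) = imult u - imult v"
    "imult (- u) = - imult u" "imult (c *\<^sub>R u) = c *\<^sub>R imult u" "imult (imult u) = - u"
  by (simp_all add: vec_eq_iff algebra_simps)

lemma imult_inner:
  fixes u v :: "complex ^ ('k::finite)"
  shows "u \<bullet> imult v = - (imult u \<bullet> v)"
  unfolding inner_vec_def sum_negf[symmetric] by (rule sum.cong) (auto simp: inner_complex_def)

lemma imult_inner_swap: "imult v \<bullet> u = - (imult u \<bullet> (v :: complex ^ ('k::finite)))"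
  by (metis imult_inner inner_commute)

lemma imult_inner_self: "imult u \<bullet> (u :: complex ^ ('k::finite)) = 0"
  using imult_inner[of u u] by (simp add: inner_commute)

text \<open>The real part of the Hermitian form \<open>\<langle>u, v\<rangle> / \<rho> - \<langle>u, w\<rangle> \<langle>w, v\<rangle> / \<rho>\<^sup>2\<close> with \<open>\<rho> = 1 + \<bar>w\<bar>\<^sup>2\<close>.  The complex
inner product is expressed by real ones, \<open>\<langle>u, w\<rangle> = u \<bullet> w - \<i> (\<i>u \<bullet> w)\<close>, so that all terms are linear in
\<open>w\<close> up to the factor \<open>inverse \<rho>\<close>.\<close>

definition fs_metric :: "(complex ^ ('n::finite)) metric_coords" where
  "fs_metric w u v = inverse (1 + w \<bullet> w) * (u \<bullet> v)
     - (inverse (1 + w \<bullet> w))\<^sup>2 * ((u \<bullet> w) * (v \<bullet> w) + (imult u \<bullet> w) * (imult v \<bullet> w))"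

text \<open>The Kaehler expression \<open>- (\<langle>u, w\<rangle> v + \<langle>v, w\<rangle> u) / \<rho>\<close>, again with real inner products.\<close>

definition fs_christoffel :: "complex ^ 'n \<Rightarrow> complex ^ 'n \<Rightarrow> complex ^ 'n \<Rightarrow> complex ^ ('n::finite)" where
  "fs_christoffel w u v = - (inverse (1 + w \<bullet> w) *\<^sub>R
     ((u \<bullet> w) *\<^sub>R v - (imult u \<bullet> w) *\<^sub>R imult v + (v \<bullet> w) *\<^sub>R u - (imult v \<bullet> w) *\<^sub>R imult u))"

lemma sum_UNIV_transpose_None:
  fixes f :: "'n::finite option \<Rightarrow> 'b::comm_monoid_add"
  shows "(\<Sum>i\<in>UNIV. f (Transposition.transpose None k i)) = f None + (\<Sum>j\<in>UNIV. f (Some j))"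
proof -
  have "(\<Sum>i\<in>UNIV. f (Transposition.transpose None k i)) = (\<Sum>i\<in>UNIV. f i)"
    by (rule sum.reindex_bij_betw) (simp add: bij_betw_def)
  also have "\<dots> = f None + (\<Sum>j\<in>UNIV. f (Some j))"
    by (simp add: UNIV_option_conv sum.reindex)
  finally show ?thesis .
qed

text \<open>The linear part of the affine map \<open>affine_lift k\<close>.\<close>

definition lift_direction :: "'n option \<Rightarrow> complex ^ 'n \<Rightarrow> complex ^ ('n::finite option)" where
  "lift_direction k u = (\<chi> i. case Transposition.transpose None k i of None \<Rightarrow> 0 | Some j \<Rightarrow> u $ j)"

lemma affine_lift_split: "affine_lift k w = affine_lift k 0 + lift_direction k w"
  by (auto simp: affine_lift_def lift_direction_def vec_eq_iff split: option.split)

lemma bounded_linear_lift_direction: "bounded_linear (lift_direction k)"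
  by (intro linear_conv_bounded_linear[THEN iffD1] linearI)
    (auto simp: lift_direction_def vec_eq_iff split: option.split)

lemma inner_option_vec:
  fixes f g :: "'n::finite option \<Rightarrow> complex"
  shows "(\<chi> i. f (Transposition.transpose None k i)) \<bullet> (\<chi> i. g (Transposition.transpose None k i))
     = f None \<bullet> g None + (\<Sum>j\<in>UNIV. f (Some j) \<bullet> g (Some j))"
  unfolding inner_vec_def using sum_UNIV_transpose_None[of "\<lambda>i. f i \<bullet> g i" k] by simp

lemma inner_lifts:
  fixes u v w :: "complex ^ ('n::finite)"
  shows "lift_direction k u \<bullet> lift_direction k v = u \<bullet> v"
    "lift_direction k u \<bullet> affine_lift k w = u \<bullet> w"
    "affine_lift k w \<bullet> affine_lift k w = 1 + w \<bullet> w"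
  unfolding lift_direction_def affine_lift_def
  by (subst inner_option_vec; simp add: inner_vec_def)+

lemma imult_lift_direction: "imult (lift_direction k u) = lift_direction k (imult u)"
  by (auto simp: lift_direction_def vec_eq_iff split: option.split)

lemma sphere_lift_has_derivative:
  fixes w :: "complex ^ ('n::finite)"
  shows "(sphere_lift k has_derivative (\<lambda>u. inverse (norm (affine_lift k w)) *\<^sub>R
     (lift_direction k u - (lift_direction k u \<bullet> sphere_lift k w) *\<^sub>R sphere_lift k w))) (at w)"
proof -
  have A: "(affine_lift k has_derivative lift_direction k) (at w)"
    by (subst affine_lift_split[abs_def], rule has_derivative_eq_rhs[OF has_derivative_add[OF has_derivative_const
            bounded_linear_imp_has_derivative[OF bounded_linear_lift_direction]]]) simp
  have nz: "affine_lift k w \<noteq> 0"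
    using norm_sphere_lift[of k w] by (auto simp: sphere_lift_def)
  have N: "((\<lambda>w. norm (affine_lift k w)) has_derivative (\<lambda>u. sgn (affine_lift k w) \<bullet> lift_direction k u)) (at w)"
    using has_derivative_compose[OF A has_derivative_norm[OF nz]] by (simp add: inner_commute)
  show ?thesis
    unfolding sphere_lift_def[abs_def]
    apply (rule has_derivative_eq_rhs)
     apply (rule has_derivative_scaleR[OF Deriv.has_derivative_inverse[OF _ N] A])
    using nz by (auto simp: fun_eq_iff sgn_div_norm algebra_simps inner_commute)
qed

text \<open>All charts have the same metric because the affine lifts for different \<open>k\<close> differ by a
permutation of the coordinates, which is an isometry.  The formula is found by removing from the derivative
of the normalized lift \<open>Z\<close> the components along \<open>Z\<close> and \<open>\<i>Z\<close>.\<close>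

lemma fubini_study_coords_eq: "fubini_study_coords k = (fs_metric :: (complex ^ ('n::finite)) metric_coords)"
proof (intro ext)
  fix w u v :: "complex ^ 'n"
  define Z where "Z = sphere_lift k w"
  define N where "N = norm (affine_lift k w)"
  define D where "D u = inverse N *\<^sub>R (lift_direction k u - (lift_direction k u \<bullet> Z) *\<^sub>R Z)" for u
  have N2: "N\<^sup>2 = 1 + w \<bullet> w" by (simp add: N_def dot_square_norm[symmetric] inner_lifts)
  have r: "(inverse N)\<^sup>2 = inverse (1 + w \<bullet> w)" unfolding N2[symmetric] by (simp add: power_inverse)
  have ZZ: "Z \<bullet> Z = 1" using norm_sphere_lift[of k w] by (simp add: Z_def dot_square_norm)
  have iZZ: "imult Z \<bullet> imult Z = 1" using ZZ by (simp add: inner_vector_scalar_mult)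
  have Ziz: "Z \<bullet> imult Z = 0" using imult_inner_self[of Z] by (simp add: inner_commute)
  have ZN: "Z = inverse N *\<^sub>R affine_lift k w" by (simp add: Z_def N_def sphere_lift_def)
  have LZ: "lift_direction k u \<bullet> Z = inverse N * (u \<bullet> w)" for u
    by (simp add: ZN inner_lifts)
  have LiZ: "lift_direction k u \<bullet> imult Z = - (inverse N * (imult u \<bullet> w))" for u
    by (simp add: imult_inner imult_lift_direction LZ)
  have fd: "frechet_derivative (sphere_lift k) (at w) = D"
    using frechet_derivative_at[OF sphere_lift_has_derivative[of k w]] by (simp add: D_def[abs_def] Z_def N_def)
  have DD: "D u \<bullet> D v = (inverse N)\<^sup>2 * (u \<bullet> v - (lift_direction k u \<bullet> Z) * (lift_direction k v \<bullet> Z))" for u v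
    unfolding D_def by (simp add: inner_diff_left inner_diff_right inner_lifts ZZ
        inner_commute[of Z "lift_direction k _"] power2_eq_square algebra_simps)
  have DiZ: "D u \<bullet> imult Z = - ((inverse N)\<^sup>2 * (imult u \<bullet> w))" for u
    unfolding D_def by (simp add: inner_diff_left LiZ Ziz power2_eq_square)
  have "fubini_study_coords k w u v = horizontal_part Z (D u) \<bullet> horizontal_part Z (D v)"
    by (simp add: fubini_study_coords_def Let_def fd Z_def)
  also have "\<dots> = D u \<bullet> D v - (D u \<bullet> imult Z) * (D v \<bullet> imult Z)"
    unfolding horizontal_part_def
    by (simp add: inner_diff_left inner_diff_right iZZ inner_commute[of "imult Z" "D _"])
  also have "\<dots> = fs_metric w u v"
    unfolding DD DiZ LZ fs_metric_def r[symmetric] by (simp add: power2_eq_square algebra_simps)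
  finally show "fubini_study_coords k w u v = fs_metric w u v" .
qed

lemma metric_dualI:
  assumes "\<And>w. g x v w = L w" and "\<And>v v'. (\<And>w. g x v w = g x v' w) \<Longrightarrow> v = v'"
  shows "metric_dual g x L = v"
  unfolding metric_dual_def using assms by (intro the_equality) auto

lemma fs_metric_linear:
  fixes w :: "complex ^ ('n::finite)"
  shows "fs_metric w (u + u') v = fs_metric w u v + fs_metric w u' v"
   "fs_metric w (u - u') v = fs_metric w u v - fs_metric w u' v"
   "fs_metric w (c *\<^sub>R u) v = c * fs_metric w u v"
  by (simp_all add: fs_metric_def imult_simps inner_add_left inner_diff_left algebra_simps)

text \<open>If \<open>d\<close> is in the kernel, then \<open>d\<close> is a complex multiple of \<open>w\<close>, namely \<open>(\<langle>d, w\<rangle> / \<rho>) w\<close>; pairing this with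
\<open>w\<close> gives \<open>\<langle>d, w\<rangle> = 0\<close> since \<open>\<bar>w\<bar>\<^sup>2 < \<rho>\<close>.\<close>

lemma fs_metric_nondegenerate:
  fixes w :: "complex ^ ('n::finite)"
  assumes eq: "\<And>x. fs_metric w u x = fs_metric w v x"
  shows "u = v"
proof -
  define d where "d = u - v"
  define r where "r = inverse (1 + w \<bullet> w)"
  define a where "a = r * (d \<bullet> w)"
  define b where "b = r * (imult d \<bullet> w)"
  have pos: "1 + w \<bullet> w > 0" by (smt (verit) inner_ge_zero)
  have r: "r > 0" using pos by (simp add: r_def)
  \<comment> \<open>the inequality \<open>\<bar>w\<bar>\<^sup>2 < \<rho>\<close>, in the form that a factor \<open>r \<bar>w\<bar>\<^sup>2\<close> differs from 1\<close>
  have rw: "r * (w \<bullet> w) = 1 - r" using pos by (simp add: r_def field_simps)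
  have "fs_metric w d x = 0" for x
    using eq by (simp add: d_def fs_metric_linear)
  moreover have "fs_metric w d x = r * ((d - a *\<^sub>R w + b *\<^sub>R imult w) \<bullet> x)" for x
    unfolding fs_metric_def r_def[symmetric] a_def b_def
    by (simp add: inner_add_left inner_diff_left imult_simps algebra_simps power2_eq_square
        inner_commute[of w x] imult_inner_swap[of w x])
  ultimately have "(d - a *\<^sub>R w + b *\<^sub>R imult w) \<bullet> x = 0" for x
    using r by auto
  then have "d - a *\<^sub>R w + b *\<^sub>R imult w = 0"
    by (metis inner_eq_zero_iff)
  then have dd: "d = a *\<^sub>R w - b *\<^sub>R imult w" by (simp add: algebra_simps)
  have "a = a * (r * (w \<bullet> w))"
    unfolding a_def by (subst dd) (simp add: inner_diff_left imult_inner_self a_def)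
  then have a: "a = 0" using r unfolding rw by (simp add: algebra_simps)
  have "imult d = a *\<^sub>R imult w + b *\<^sub>R w" by (subst dd) (simp add: imult_simps)
  then have "imult d \<bullet> w = b * (w \<bullet> w)"
    by (simp add: inner_add_left imult_inner_self)
  then have "b = b * (r * (w \<bullet> w))"
    by (metis b_def mult.left_commute)
  then have b: "b = 0" using r unfolding rw by (simp add: algebra_simps)
  show ?thesis using dd a b by (simp add: d_def)
qed

lemma fs_metric_has_derivative:
  fixes w u v :: "complex ^ ('n::finite)"
  defines "r \<equiv> inverse (1 + w \<bullet> w)"
  shows "((\<lambda>y. fs_metric y u v) has_derivative (\<lambda>x.
     - (2 * r\<^sup>2 * (x \<bullet> w) * (u \<bullet> v))
     + 4 * r ^ 3 * (x \<bullet> w) * ((u \<bullet> w) * (v \<bullet> w) + (imult u \<bullet> w) * (imult v \<bullet> w))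
     - r\<^sup>2 * ((u \<bullet> x) * (v \<bullet> w) + (u \<bullet> w) * (v \<bullet> x) + (imult u \<bullet> x) * (imult v \<bullet> w)
        + (imult u \<bullet> w) * (imult v \<bullet> x)))) (at w)"
proof -
  have pos: "1 + w \<bullet> w > 0" by (smt (verit) inner_ge_zero)
  show ?thesis
    unfolding fs_metric_def r_def using pos
    apply -
    apply (rule has_derivative_eq_rhs)
     apply (rule derivative_intros | simp)+
    apply (rule ext)
    subgoal for x by (simp add: algebra_simps power2_eq_square power3_eq_cube inner_commute[of w x])
    done
qed

text \<open>With \<open>inverse \<rho>\<close> treated as an indeterminate, the Koszul formula is a polynomial identity in the
inner products of the vectors.\<close>

lemma christoffel_fs_metric: "christoffel fs_metric w u v = fs_christoffel w u (v :: complex ^ ('n::finite))"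
  unfolding christoffel_def
proof (rule metric_dualI[OF _ fs_metric_nondegenerate])
  fix x :: "complex ^ 'n"
  have "(frechet_derivative (\<lambda>y. fs_metric y v x) (at w) u
      + frechet_derivative (\<lambda>y. fs_metric y u x) (at w) v
      - frechet_derivative (\<lambda>y. fs_metric y u v) (at w) x) = 2 * fs_metric w (fs_christoffel w u v) x"
    unfolding frechet_derivative_eqI[OF fs_metric_has_derivative]
    unfolding fs_metric_def fs_christoffel_def
    by (simp add: inner_add_left inner_diff_left imult_simps imult_inner_self imult_inner
       inner_commute[of v u] inner_commute[of x u] inner_commute[of x v]
       inner_commute[of w u] inner_commute[of w v] inner_commute[of w x]
       imult_inner_swap[of v u] imult_inner_swap[of x u] imult_inner_swap[of x v]
       imult_inner_swap[of w u] imult_inner_swap[of w v] imult_inner_swap[of w x] algebra_simps power2_eq_square power3_eq_cube)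
  then show "fs_metric w (fs_christoffel w u v) x =
      (frechet_derivative (\<lambda>y. fs_metric y v x) (at w) u
      + frechet_derivative (\<lambda>y. fs_metric y u x) (at w) v
      - frechet_derivative (\<lambda>y. fs_metric y u v) (at w) x) / 2" by simp
qed

section \<open>The Fubini-Study curvature\<close>

lemma pullback_conn_fs_const:
  "pullback_conn fs_metric (\<lambda>q. q) (\<lambda>q. Z) q Y = fs_christoffel q Y Z"
  by (simp add: pullback_conn_def christoffel_fs_metric)

lemma fs_christoffel_has_derivative:
  fixes w :: "complex ^ ('n::finite)"
  defines "r \<equiv> inverse (1 + w \<bullet> w)"
  shows "((\<lambda>y. fs_christoffel y u v) has_derivative (\<lambda>x.
     (2 * r\<^sup>2 * (x \<bullet> w)) *\<^sub>R
       ((u \<bullet> w) *\<^sub>R v - (imult u \<bullet> w) *\<^sub>R imult v + (v \<bullet> w) *\<^sub>R u - (imult v \<bullet> w) *\<^sub>R imult u)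
     - r *\<^sub>R ((u \<bullet> x) *\<^sub>R v - (imult u \<bullet> x) *\<^sub>R imult v + (v \<bullet> x) *\<^sub>R u - (imult v \<bullet> x) *\<^sub>R imult u))) (at w)"
proof -
  have pos: "1 + w \<bullet> w \<noteq> 0" by (smt (verit) inner_ge_zero)
  have r: "((\<lambda>y. inverse (1 + y \<bullet> y)) has_derivative (\<lambda>x. - (2 * r\<^sup>2 * (x \<bullet> w)))) (at w)"
    unfolding r_def
    apply (rule has_derivative_eq_rhs)
     apply (rule derivative_intros pos | simp)+
    apply (rule ext)
    subgoal for x by (simp add: power2_eq_square inner_commute[of w x])
    done
  show ?thesis
    unfolding fs_christoffel_def
    apply (rule has_derivative_eq_rhs)
     apply (rule has_derivative_minus has_derivative_scaleR_left has_derivative_scaleR[OF r] has_derivative_add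
         has_derivative_diff has_derivative_inner_right has_derivative_ident)+
    apply (rule ext)
    subgoal for x by (simp add: r_def)
    done
qed

text \<open>The curvature tensor of a complex space form of holomorphic sectional curvature 4.\<close>

lemma curvature_tensor_fs_metric:
  fixes p X Y Z :: "complex ^ ('n::finite)"
  shows "curvature_tensor fs_metric p X Y Z =
    fs_metric p Z Y *\<^sub>R X - fs_metric p Z X *\<^sub>R Y
    - fs_metric p (imult Z) Y *\<^sub>R imult X + fs_metric p (imult Z) X *\<^sub>R imult Y
    - (2 * fs_metric p (imult X) Y) *\<^sub>R imult Z"
proof (rule euclidean_eqI)
  fix b :: "complex ^ 'n"
  have conn: "pullback_conn fs_metric (\<lambda>q. q) (\<lambda>q. fs_christoffel q U Z) p V
     = frechet_derivative (\<lambda>q. fs_christoffel q U Z) (at p) V + fs_christoffel p V (fs_christoffel p U Z)"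
    for U V :: "complex ^ 'n"
    by (simp add: pullback_conn_def christoffel_fs_metric)
  show "curvature_tensor fs_metric p X Y Z \<bullet> b = (fs_metric p Z Y *\<^sub>R X - fs_metric p Z X *\<^sub>R Y
    - fs_metric p (imult Z) Y *\<^sub>R imult X + fs_metric p (imult Z) X *\<^sub>R imult Y
    - (2 * fs_metric p (imult X) Y) *\<^sub>R imult Z) \<bullet> b"
    unfolding curvature_tensor_def pullback_conn_fs_const conn
      frechet_derivative_eqI[OF fs_christoffel_has_derivative]
    unfolding fs_metric_def fs_christoffel_def
    unfolding inner_add_left inner_diff_left inner_minus_left inner_scaleR_left
    by (simp add: inner_add_left inner_diff_left imult_simps imult_inner
       inner_commute[of Y X] inner_commute[of Z X] inner_commute[of Z Y]
       imult_inner_swap[of Y X] imult_inner_swap[of Z X] imult_inner_swap[of Z Y]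
       algebra_simps power2_eq_square)
qed

section \<open>Weighted covariance and the connection of the torus\<close>

text \<open>The induced metric of the torus in terms of angles.\<close>

definition weighted_cov :: "real ^ 'n \<Rightarrow> real ^ 'n \<Rightarrow> real ^ 'n \<Rightarrow> real" where
  "weighted_cov p s t = p \<bullet> (s * t) - (p \<bullet> s) * (p \<bullet> t)"

text \<open>The algebraic part of the covariant derivative of vector fields along the torus.  It is also, up to sign, the second
fundamental form.\<close>

definition torus_conn :: "real ^ 'n \<Rightarrow> real ^ 'n \<Rightarrow> real ^ 'n \<Rightarrow> real ^ 'n" where
  "torus_conn p s t = s * t - (p \<bullet> s) *\<^sub>R t - (p \<bullet> t) *\<^sub>R s"

text \<open>Diagonal weights make the axes orthogonal, and the covariance form is a rank one
perturbation of the diagonal form.  By the Sherman-Morrison formula its inverse is diagonal plus a multiple of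
the square of the constant vector \<open>1\<close>.  So traces with respect to it are sums over the
axes and this one additional vector, with the weights \<open>1 / p\<^sub>j\<close> and \<open>1 / p\<^sub>0\<close> of \<open>frame_weight\<close> below.\<close>

definition frame_vec :: "'n option \<Rightarrow> real ^ 'n" where
  "frame_vec i = (case i of None \<Rightarrow> 1 | Some j \<Rightarrow> axis j 1)"

lemma sum_UNIV_option:
  fixes f :: "'n::finite option \<Rightarrow> 'b::comm_monoid_add"
  shows "(\<Sum>i\<in>UNIV. f i) = f None + (\<Sum>j\<in>UNIV. f (Some j))"
  by (simp add: UNIV_option_conv sum.reindex)

lemma weighted_cov_sym: "weighted_cov p s t = weighted_cov p t s"
  by (simp add: weighted_cov_def mult.commute)

lemma bilinear_weighted_cov: "bilinear (weighted_cov (p :: real ^ ('n::finite)))"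
  unfolding bilinear_def linear_iff weighted_cov_def
  by (auto simp: inner_vec_def algebra_simps sum.distrib sum_distrib_left)

lemma bilinear_torus_conn: "bilinear (torus_conn (p :: real ^ ('n::finite)))"
  unfolding bilinear_def linear_iff torus_conn_def
  by (auto simp: vec_eq_iff inner_add_right algebra_simps)

locale torus_weights =
  fixes p :: "real ^ ('n::finite)" and p0 :: real
  assumes p_pos: "\<And>j. p $ j > 0" and p0_pos: "p0 > 0" and p_sum: "p \<bullet> 1 = 1 - p0"
begin

definition frame_weight :: "'n option \<Rightarrow> real" where
  "frame_weight i = (case i of None \<Rightarrow> 1 / p0 | Some j \<Rightarrow> 1 / p $ j)"

lemma p_axis: "p \<bullet> axis j 1 = p $ j"
  by (simp add: inner_axis)

lemma times_axis: "v * axis j 1 = (v $ j) *\<^sub>R axis j (1::real)"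
  and axis_times: "axis j 1 * v = (v $ j) *\<^sub>R axis j (1::real)"
  by (simp_all add: vec_eq_iff axis_def)

lemma weighted_cov_axis: "weighted_cov p v (axis j 1) / p $ j = v $ j - p \<bullet> v"
proof -
  have "weighted_cov p v (axis j 1) = (v $ j - p \<bullet> v) * p $ j"
    by (simp add: weighted_cov_def times_axis p_axis left_diff_distrib)
  then show ?thesis using p_pos[of j] by simp
qed

lemma weighted_cov_one: "weighted_cov p v 1 / p0 = p \<bullet> v"
proof -
  have "weighted_cov p v 1 = (p \<bullet> v) * p0"
    by (simp add: weighted_cov_def p_sum right_diff_distrib)
  then show ?thesis using p0_pos by simp
qed

lemma torus_conn_axis: "torus_conn p (axis j 1) x = (x $ j - p \<bullet> x) *\<^sub>R axis j 1 - p $ j *\<^sub>R x"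
  by (simp add: torus_conn_def axis_times p_axis scaleR_diff_left)

lemma torus_conn_one: "torus_conn p 1 x = p0 *\<^sub>R x - (p \<bullet> x) *\<^sub>R 1"
  by (simp add: torus_conn_def p_sum scaleR_diff_left)

text \<open>This is the matrix identity \<open>G\<^sup>-\<^sup>1 G = 1\<close> for the Sherman-Morrison inverse \<open>G\<^sup>-\<^sup>1\<close>.\<close>

lemma frame_reproduces:
  "(\<Sum>i\<in>UNIV. (frame_weight i * weighted_cov p v (frame_vec i)) *\<^sub>R frame_vec i) = v"
proof -
  have "(\<Sum>j\<in>UNIV. ((weighted_cov p v (axis j 1)) / p $ j) *\<^sub>R axis j 1) = v - (p \<bullet> v) *\<^sub>R 1"
  proof -
    have "(v $ j - p \<bullet> v) * axis j 1 $ l = (if j = l then v $ l - p \<bullet> v else 0)" for j l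
      by (simp add: axis_def)
    then show ?thesis
      unfolding weighted_cov_axis vec_eq_iff sum_component vector_scaleR_component real_scaleR_def
      by (simp only: sum.delta' finite_class.finite_UNIV) simp
  qed
  then show ?thesis
    by (simp add: weighted_cov_one sum_UNIV_option frame_weight_def frame_vec_def)
qed

lemma weighted_cov_nondegenerate:
  assumes "\<And>t. weighted_cov p s t = weighted_cov p s' t"
  shows "s = s'"
  by (subst (1 2) frame_reproduces[symmetric]) (simp only: assms)

lemma frame_cov_trace:
  "(\<Sum>i\<in>UNIV. frame_weight i * weighted_cov p (frame_vec i) (frame_vec i)) = CARD('n)"
proof -
  have "(\<Sum>j\<in>UNIV. p $ j) = 1 - p0"
    using p_sum by (simp add: inner_vec_def)
  then show ?thesis
    by (simp add: weighted_cov_one weighted_cov_axis p_sum p_axis sum_UNIV_option frame_weight_def frame_vec_def sum_subtractf)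
qed

definition torus_tension :: "real ^ 'n" where
  "torus_tension = (\<Sum>i\<in>UNIV. frame_weight i *\<^sub>R torus_conn p (frame_vec i) (frame_vec i))"

lemma torus_tension_nth: "torus_tension $ l = 1 / p $ l - 1 / p0"
proof -
  have "torus_conn p (axis j 1) (axis j 1) $ l / p $ j = (if j = l then 1 / p $ l - 2 else 0)" for j
    using p_pos[of j] p_pos[of l] by (simp add: torus_conn_axis p_axis) (simp add: axis_def field_simps)
  moreover have "torus_conn p 1 1 $ l / p0 = 2 - 1 / p0"
    using p0_pos by (simp add: torus_conn_one p_sum) (simp add: field_simps)
  ultimately show ?thesis
    by (simp add: torus_tension_def sum_UNIV_option frame_weight_def frame_vec_def)
qed

lemma p_torus_tension: "p \<bullet> torus_tension = CARD('n) + 1 - 1 / p0"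
proof -
  have "p $ j * torus_tension $ j = 1 - (1 / p0) * p $ j" for j
    using p_pos[of j] by (simp add: torus_tension_nth field_simps)
  moreover have "(\<Sum>j\<in>UNIV. p $ j) = 1 - p0"
    using p_sum by (simp add: inner_vec_def)
  ultimately have "p \<bullet> torus_tension = CARD('n) - (1 / p0) * (1 - p0)"
    by (simp add: inner_vec_def sum_subtractf flip: sum_distrib_left sum_divide_distrib)
  then show ?thesis using p0_pos by (simp add: field_simps)
qed

text \<open>Multiplication by an axis vector is a coordinate projection, so both applications of the connection are
explicit; the sum over the axes and the term for the constant vector each contain \<open>3 (p \<bullet> v)\<close>, with opposite signs.\<close>

lemma frame_conn_conn_trace:
  "(\<Sum>i\<in>UNIV. frame_weight i *\<^sub>R torus_conn p (frame_vec i) (torus_conn p (frame_vec i) v)) $ l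
   = (v $ l - p \<bullet> v) / p $ l - 2 * v $ l + (p \<bullet> v) / p0"
proof -
  define m where "m = p \<bullet> v"
  have psum: "(\<Sum>j\<in>UNIV. p $ j) = 1 - p0"
    using p_sum by (simp add: inner_vec_def)
  have "torus_conn p (axis j 1) (torus_conn p (axis j 1) v) $ l / p $ j
      = (if j = l then (v $ l - m) / p $ l - 3 * v $ l + 3 * m else 0) + p $ j * v $ l" for j
    using p_pos[of j] p_pos[of l]
    by (simp add: torus_conn_axis p_axis inner_diff_right m_def[symmetric]) (simp add: axis_def field_simps)
  moreover have "torus_conn p 1 (torus_conn p 1 v) $ l / p0 = p0 * v $ l - 3 * m + m / p0"
    using p0_pos by (simp add: torus_conn_one inner_diff_right p_sum m_def[symmetric])
      (simp add: field_simps power2_eq_square)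
  ultimately show ?thesis
    by (simp add: sum_UNIV_option frame_weight_def frame_vec_def m_def[symmetric] sum.distrib psum
        flip: sum_distrib_right)
      (simp add: algebra_simps)
qed

lemma torus_bitension:
  defines "t \<equiv> torus_tension"
  shows "((\<Sum>i\<in>UNIV. frame_weight i *\<^sub>R torus_conn p (frame_vec i) (torus_conn p (frame_vec i) t))
      - (CARD('n) + 3) *\<^sub>R t) $ l
   = (1 / p $ l - 1 / p0) * (1 / p $ l + 1 / p0 - 2 * (CARD('n) + 3))"
proof -
  have *: "(P - q - (N + 1 - q)) * P - 2 * (P - q) + (N + 1 - q) * q - (N + 3) * (P - q)
    = (P - q) * (P + q - 2 * (N + 3))" for P q N :: real
    by (simp add: algebra_simps)
  show ?thesis
    unfolding t_def vector_minus_component vector_scaleR_component frame_conn_conn_trace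
      torus_tension_nth p_torus_tension
    using *[of "inverse (p $ l)" "inverse p0" "CARD('n)"] by (simp add: divide_inverse algebra_simps)
qed

end

section \<open>Vector fields along a torus in affine coordinates\<close>

text \<open>The frame condition says that the inverse metric is \<open>\<Sum> c i (s i \<otimes> s i)\<close>.  This covers families with
more members than the dimension, such as the one given by \<open>frame_vec\<close>.\<close>

lemma metric_trace_frame:
  fixes g :: "'u::euclidean_space metric_coords" and \<beta> :: "'u \<Rightarrow> 'u \<Rightarrow> 'b::real_vector"
  assumes g: "bilinear (g x)" and sym: "\<And>u v. g x u v = g x v u"
    and \<beta>: "bilinear \<beta>" and I: "finite I"
    and frame: "\<And>v. (\<Sum>i\<in>I. (c i * g x v (s i)) *\<^sub>R s i) = v"
  shows "metric_trace g x \<beta> = (\<Sum>i\<in>I. c i *\<^sub>R \<beta> (s i) (s i))"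
proof -
  have lin1: "linear (\<lambda>u. g x u v)" for v
    using g by (simp add: bilinear_def)
  have blin1: "linear (\<lambda>u. \<beta> u v)" and blin2: "linear (\<beta> v)" for v
    using \<beta> by (simp_all add: bilinear_def)
  have dual: "metric_dual g x (\<lambda>w. b \<bullet> w) = (\<Sum>i\<in>I. (c i * (b \<bullet> s i)) *\<^sub>R s i)" for b
  proof (rule metric_dualI)
    fix w
    have "g x (\<Sum>i\<in>I. (c i * (b \<bullet> s i)) *\<^sub>R s i) w = (\<Sum>i\<in>I. c i * (b \<bullet> s i) * g x (s i) w)"
      by (simp add: linear_sum[OF lin1] linear_scale[OF lin1])
    also have "\<dots> = b \<bullet> (\<Sum>i\<in>I. (c i * g x w (s i)) *\<^sub>R s i)"
      by (simp add: inner_sum_right sym[of "s _"] mult.commute mult.left_commute)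
    finally show "g x (\<Sum>i\<in>I. (c i * (b \<bullet> s i)) *\<^sub>R s i) w = b \<bullet> w"
      by (simp only: frame)
  next
    fix v v' assume "\<And>w. g x v w = g x v' w"
    then have "(\<Sum>i\<in>I. (c i * g x v (s i)) *\<^sub>R s i) = (\<Sum>i\<in>I. (c i * g x v' (s i)) *\<^sub>R s i)" by (simp only:)
    then show "v = v'" by (simp only: frame)
  qed
  have "metric_trace g x \<beta> = (\<Sum>b\<in>Basis. \<Sum>i\<in>I. c i *\<^sub>R (b \<bullet> s i) *\<^sub>R \<beta> b (s i))"
    by (simp add: metric_trace_def dual linear_sum[OF blin2] linear_scale[OF blin2])
  also have "\<dots> = (\<Sum>i\<in>I. c i *\<^sub>R \<beta> (\<Sum>b\<in>Basis. (s i \<bullet> b) *\<^sub>R b) (s i))"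
    by (subst sum.swap) (simp add: linear_sum[OF blin1] linear_scale[OF blin1] scaleR_sum_right inner_commute)
  finally show ?thesis by (simp add: euclidean_representation)
qed

text \<open>The vector at \<open>w\<close> with the components \<open>c s\<^sub>j w\<^sub>j\<close>.  At a point of the torus, imaginary \<open>c\<close> give the tangent vectors
and real \<open>c\<close> the normal vectors.\<close>

definition along :: "complex ^ 'n \<Rightarrow> complex \<Rightarrow> real ^ 'n \<Rightarrow> complex ^ 'n" where
  "along w c s = (\<chi> j. c * complex_of_real (s $ j) * w $ j)"

lemma along_simps:
  fixes w :: "complex ^ ('n::finite)"
  shows "along w c (s + t) = along w c s + along w c t"
    "along w c (s - t) = along w c s - along w c t"
    "along w c (- s) = - along w c s"
    "along w c (a *\<^sub>R s) = a *\<^sub>R along w c s"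
    "along w c 0 = 0"
    "along w (- c) s = - along w c s"
    "imult (along w c s) = along w (\<i> * c) s"
  by (simp_all add: along_def vec_eq_iff algebra_simps) (simp_all add: scaleR_conv_of_real)

lemma linear_along: "linear (along w c :: real ^ 'n \<Rightarrow> complex ^ ('n::finite))"
  by (rule linearI) (simp_all add: along_simps)

lemma along_cong_inj:
  fixes w :: "complex ^ ('n::finite)"
  assumes "\<And>j. w $ j \<noteq> 0" "c \<noteq> 0" "along w c s = along w c t"
  shows "s = t"
  using assms by (simp add: along_def vec_eq_iff)

lemma has_derivative_cart:
  fixes f :: "'a::euclidean_space \<Rightarrow> 'b::euclidean_space ^ ('n::finite)"
  shows "(f has_derivative f') (at x) \<longleftrightarrow> (\<forall>j. ((\<lambda>y. f y $ j) has_derivative (\<lambda>h. f' h $ j)) (at x))"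
proof
  show "(f has_derivative f') (at x) \<Longrightarrow> \<forall>j. ((\<lambda>y. f y $ j) has_derivative (\<lambda>h. f' h $ j)) (at x)"
    using bounded_linear.has_derivative[OF bounded_linear_vec_nth] by blast
next
  assume *: "\<forall>j. ((\<lambda>y. f y $ j) has_derivative (\<lambda>h. f' h $ j)) (at x)"
  have "((\<lambda>y. f y \<bullet> b) has_derivative (\<lambda>h. f' h \<bullet> b)) (at x)" if "b \<in> Basis" for b
  proof -
    obtain j e where "b = axis j e" using \<open>b \<in> Basis\<close> by (auto simp: Basis_vec_def)
    then show ?thesis
      using has_derivative_inner_left[OF *[rule_format, of j], of e] by (simp add: inner_axis)
  qed
  then show "(f has_derivative f') (at x)"
    using has_derivative_componentwise_within[of f f' x UNIV] by simp
qed

text \<open>The coordinate expression, in an affine chart, of an arbitrary parametrization of a piece of a torus, with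
the induced metric.  The bitension field has four derivatives of \<open>F\<close> in its definition, but \<open>F\<close> of class \<open>C\<^sup>2\<close> is a sufficient assumption: the
tension field turns out to be an explicit expression in \<open>F\<close> itself.\<close>

locale torus_immersion =
  fixes F :: "real ^ 'n \<Rightarrow> complex ^ ('n::finite)" and D :: "(real ^ 'n) set" and r :: "real ^ 'n"
    and g :: "(real ^ 'n) metric_coords"
  assumes open_D: "open D" and C2: "Ck_on 2 F D"
    and r_pos: "\<And>j. r $ j > 0" and cmod_F: "\<And>x j. x \<in> D \<Longrightarrow> cmod (F x $ j) = r $ j"
    and inj_dF: "\<And>x. x \<in> D \<Longrightarrow> inj (frechet_derivative F (at x))"
    and g_eq: "\<And>x \<xi> \<eta>. x \<in> D \<Longrightarrow>
      g x \<xi> \<eta> = fs_metric (F x) (frechet_derivative F (at x) \<xi>) (frechet_derivative F (at x) \<eta>)"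
begin

definition p :: "real ^ 'n" where "p = (\<chi> j. (r $ j)\<^sup>2 / (1 + r \<bullet> r))"
definition p0 :: real where "p0 = 1 / (1 + r \<bullet> r)"

lemma rho_pos: "1 + r \<bullet> r > 0"
  by (smt (verit) inner_ge_zero)

sublocale torus_weights p p0
proof
  show "p $ j > 0" for j
    using rho_pos r_pos[of j] by (simp add: p_def)
  show "p0 > 0" using rho_pos by (simp add: p0_def)
  have "p \<bullet> 1 = (\<Sum>j\<in>UNIV. r $ j * r $ j) / (1 + r \<bullet> r)"
    by (simp add: inner_vec_def p_def sum_divide_distrib power2_eq_square)
  also have "\<dots> = (r \<bullet> r) / (1 + r \<bullet> r)"
    by (simp add: inner_vec_def)
  finally show "p \<bullet> 1 = 1 - p0" using rho_pos by (simp add: p0_def field_simps)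
qed

lemma F_nonzero: "x \<in> D \<Longrightarrow> F x $ j \<noteq> 0"
  using cmod_F[of x j] r_pos[of j] by auto

lemma along_inner_along:
  assumes x: "x \<in> D"
  shows "along (F x) c s \<bullet> along (F x) c' t = Re (c * cnj c') * ((1 + r \<bullet> r) * (p \<bullet> (s * t)))"
proof -
  have "along (F x) c s $ j \<bullet> along (F x) c' t $ j = Re (c * cnj c') * ((r $ j)\<^sup>2 * (s $ j * t $ j))" for j
  proof -
    have "(r $ j)\<^sup>2 = (Re (F x $ j))\<^sup>2 + (Im (F x $ j))\<^sup>2"
      using cmod_F[OF x, of j] by (metis cmod_power2)
    then show ?thesis
      by (simp add: along_def inner_complex_def algebra_simps power2_eq_square)
  qed
  moreover have "(1 + r \<bullet> r) * (p \<bullet> (s * t)) = (\<Sum>j\<in>UNIV. (r $ j)\<^sup>2 * (s $ j * t $ j))"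
    using rho_pos by (simp add: inner_vec_def[of p] sum_distrib_left) (simp add: p_def)
  ultimately show ?thesis
    by (simp add: inner_vec_def[of "along _ _ _"] sum_distrib_left)
qed

lemma along_inner_F:
  assumes x: "x \<in> D"
  shows "along (F x) c s \<bullet> F x = Re c * ((1 + r \<bullet> r) * (p \<bullet> s))"
proof -
  have "F x = along (F x) 1 1" by (simp add: along_def vec_eq_iff)
  then show ?thesis using along_inner_along[OF x, of c s 1 1] by simp
qed

lemma F_inner_F: "x \<in> D \<Longrightarrow> F x \<bullet> F x = r \<bullet> r"
  unfolding inner_vec_def by (simp add: power2_norm_eq_inner[symmetric] cmod_F power2_eq_square)

lemma fs_metric_along:
  assumes x: "x \<in> D"
  shows "fs_metric (F x) (along (F x) c s) (along (F x) c' t) = Re (c * cnj c') * weighted_cov p s t"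
proof -
  define R where "R = 1 + r \<bullet> r"
  have R: "R \<noteq> 0" using rho_pos by (simp add: R_def)
  have "(inverse R)\<^sup>2 * ((a * (R * m)) * (b * (R * m')) + (a' * (R * m)) * (b' * (R * m')))
      = (a * b + a' * b') * (m * m')" for a b a' b' m m'
  proof -
    have "(inverse R)\<^sup>2 * ((a * (R * m)) * (b * (R * m')) + (a' * (R * m)) * (b' * (R * m')))
      = (inverse R * R)\<^sup>2 * ((a * b + a' * b') * (m * m'))"
      by (simp only: power2_eq_square) (simp only: algebra_simps)
    then show ?thesis using R by simp
  qed
  then show ?thesis
    using R unfolding fs_metric_def F_inner_F[OF x] along_simps along_inner_F[OF x] along_inner_along[OF x] R_def[symmetric]
    by (simp add: weighted_cov_def right_diff_distrib)
qed

lemma fs_christoffel_along: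
  assumes x: "x \<in> D"
  shows "fs_christoffel (F x) (along (F x) \<i> s) (along (F x) c t)
     = along (F x) (\<i> * c) (- ((p \<bullet> s) *\<^sub>R t) - (p \<bullet> t) *\<^sub>R s)"
proof -
  have k: "inverse (1 + r \<bullet> r) *\<^sub>R ((c * ((1 + r \<bullet> r) * m)) *\<^sub>R v) = (c * m) *\<^sub>R v" for c m and v :: "complex ^ 'n"
    using rho_pos by simp
  have "fs_christoffel (F x) (along (F x) \<i> s) (along (F x) c t)
    = - (inverse (1 + r \<bullet> r) *\<^sub>R ((1 * ((1 + r \<bullet> r) * (p \<bullet> s))) *\<^sub>R along (F x) (\<i> * c) t)
      + inverse (1 + r \<bullet> r) *\<^sub>R ((Re c * ((1 + r \<bullet> r) * (p \<bullet> t))) *\<^sub>R along (F x) \<i> s)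
      + inverse (1 + r \<bullet> r) *\<^sub>R ((Im c * ((1 + r \<bullet> r) * (p \<bullet> t))) *\<^sub>R along (F x) (- 1) s))"
    unfolding fs_christoffel_def F_inner_F[OF x] along_simps along_inner_F[OF x]
    by (simp add: algebra_simps along_simps)
  also have "\<dots> = - ((p \<bullet> s) *\<^sub>R along (F x) (\<i> * c) t
      + (p \<bullet> t) *\<^sub>R (Re c *\<^sub>R along (F x) \<i> s + Im c *\<^sub>R along (F x) (- 1) s))"
    unfolding k by (simp add: algebra_simps)
  also have "Re c *\<^sub>R along (F x) \<i> s + Im c *\<^sub>R along (F x) (- 1) s = along (F x) (\<i> * c) s"
    by (auto simp: along_def vec_eq_iff complex_eq_iff algebra_simps)
  finally show ?thesis by (simp add: along_simps)
qed

text \<open>The differentials of the arguments of the components of \<open>F\<close>, written without choosing the arguments.\<close>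

definition angular_form :: "real ^ 'n \<Rightarrow> real ^ 'n \<Rightarrow> real ^ 'n" where
  "angular_form x \<xi> = (\<chi> j. Im (cnj (F x $ j) * frechet_derivative F (at x) \<xi> $ j) / (r $ j)\<^sup>2)"

lemma F_differentiable: "x \<in> D \<Longrightarrow> F differentiable (at x)"
  and dF_differentiable: "x \<in> D \<Longrightarrow> (\<lambda>y. frechet_derivative F (at y) \<xi>) differentiable (at x)"
  using C2 by (auto simp: numeral_2_eq_2)

lemma F_has_derivative: "x \<in> D \<Longrightarrow> (F has_derivative frechet_derivative F (at x)) (at x)"
  by (rule differentiable_has_frechet_derivative[OF F_differentiable])

lemma F_nth_has_derivative:
  "x \<in> D \<Longrightarrow> ((\<lambda>y. F y $ j) has_derivative (\<lambda>\<xi>. frechet_derivative F (at x) \<xi> $ j)) (at x)"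
  using F_has_derivative has_derivative_cart by blast

lemma linear_dF: "x \<in> D \<Longrightarrow> linear (frechet_derivative F (at x))"
  using F_has_derivative has_derivative_linear by blast

text \<open>Since \<open>\<bar>F\<^sub>j\<bar>\<close> is constant, \<open>cnj F\<^sub>j dF\<^sub>j\<close> is purely imaginary.\<close>

lemma dF_eq_along:
  assumes x: "x \<in> D"
  shows "frechet_derivative F (at x) \<xi> = along (F x) \<i> (angular_form x \<xi>)"
proof -
  define v where "v = frechet_derivative F (at x) \<xi>"
  have "v $ j = \<i> * complex_of_real (angular_form x \<xi> $ j) * F x $ j" for j
  proof -
    have "((\<lambda>y. F y $ j \<bullet> F y $ j) has_derivative (\<lambda>\<xi>. F x $ j \<bullet> frechet_derivative F (at x) \<xi> $ j
        + frechet_derivative F (at x) \<xi> $ j \<bullet> F x $ j)) (at x)"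
      by (intro has_derivative_inner F_nth_has_derivative x)
    moreover have "((\<lambda>y. F y $ j \<bullet> F y $ j) has_derivative (\<lambda>\<xi>. 0)) (at x)"
      by (rule has_derivative_transform_within_open[OF has_derivative_const open_D x, of "(r $ j)\<^sup>2"])
        (simp add: power2_norm_eq_inner[symmetric] cmod_F)
    ultimately have "F x $ j \<bullet> v $ j + v $ j \<bullet> F x $ j = 0"
      unfolding v_def using fun_cong[OF has_derivative_unique, of _ _ x _ \<xi>] by blast
    then have re: "Re (cnj (F x $ j) * v $ j) = 0"
      by (simp add: inner_complex_def algebra_simps)
    have rr: "F x $ j * cnj (F x $ j) = complex_of_real ((r $ j)\<^sup>2)"
      using cmod_F[OF x] by (metis complex_norm_square)
    have i: "cnj (F x $ j) * v $ j = \<i> * complex_of_real (angular_form x \<xi> $ j * (r $ j)\<^sup>2)"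
      using re r_pos[of j] by (simp add: complex_eq_iff angular_form_def v_def)
    have "complex_of_real ((r $ j)\<^sup>2) * v $ j = F x $ j * (cnj (F x $ j) * v $ j)"
      by (simp only: rr[symmetric] mult.assoc)
    also have "\<dots> = complex_of_real ((r $ j)\<^sup>2) * (\<i> * complex_of_real (angular_form x \<xi> $ j) * F x $ j)"
      unfolding i by simp
    finally show ?thesis using r_pos[of j] by simp
  qed
  then show ?thesis by (simp add: v_def along_def vec_eq_iff)
qed

lemma linear_angular_form: "x \<in> D \<Longrightarrow> linear (angular_form x)"
  by (rule linearI; simp add: angular_form_def vec_eq_iff linear_add[OF linear_dF] linear_scale[OF linear_dF]
      algebra_simps add_divide_distrib diff_divide_distrib)

lemma inj_angular_form:
  assumes x: "x \<in> D" shows "inj (angular_form x)"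
  using inj_dF[OF x] by (auto simp: inj_def dF_eq_along[OF x])

lemma surj_angular_form: "x \<in> D \<Longrightarrow> surj (angular_form x)"
  using linear_injective_imp_surjective[OF linear_angular_form inj_angular_form] by simp

lemma angular_form_differentiable:
  assumes x: "x \<in> D" shows "(\<lambda>y. angular_form y \<xi>) differentiable (at x)"
proof -
  obtain v' where v': "((\<lambda>y. frechet_derivative F (at y) \<xi>) has_derivative v') (at x)"
    using dF_differentiable[OF x] by (auto simp: differentiable_def)
  have "((\<lambda>y. angular_form y \<xi>) has_derivative (\<lambda>h. \<chi> j.
     Im (cnj (F x $ j) * v' h $ j + cnj (frechet_derivative F (at x) h $ j) * frechet_derivative F (at x) \<xi> $ j) / (r $ j)\<^sup>2)) (at x)"
    unfolding has_derivative_cart angular_form_def vec_lambda_beta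
    by (intro allI bounded_linear.has_derivative[OF bounded_linear_divide]
        bounded_linear.has_derivative[OF bounded_linear_Im] has_derivative_mult has_derivative_cnj
        F_nth_has_derivative[OF x] v'[unfolded has_derivative_cart, rule_format])
  then show ?thesis by (rule differentiableI)
qed

definition angular_deriv :: "real ^ 'n \<Rightarrow> real ^ 'n \<Rightarrow> real ^ 'n \<Rightarrow> real ^ 'n" where
  "angular_deriv x \<xi> \<eta> = frechet_derivative (\<lambda>y. angular_form y \<eta>) (at x) \<xi>"

lemma angular_form_has_derivative:
  assumes x: "x \<in> D" shows "((\<lambda>y. angular_form y \<eta>) has_derivative (\<lambda>\<xi>. angular_deriv x \<xi> \<eta>)) (at x)"
  unfolding angular_deriv_def using differentiable_has_frechet_derivative[OF angular_form_differentiable[OF x]] .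

lemma along_has_derivative:
  assumes x: "x \<in> D" and s: "(s has_derivative s') (at x)"
    and V: "\<And>y. y \<in> D \<Longrightarrow> V y = along (F y) c (s y)"
  shows "(V has_derivative (\<lambda>\<xi>. along (F x) c (s' \<xi>) + along (F x) (\<i> * c) (angular_form x \<xi> * s x))) (at x)"
proof -
  have "((\<lambda>y. along (F y) c (s y)) has_derivative
      (\<lambda>\<xi>. along (F x) c (s' \<xi>) + along (F x) (\<i> * c) (angular_form x \<xi> * s x))) (at x)"
    unfolding has_derivative_cart
  proof
    fix j
    have 1: "((\<lambda>y. F y $ j) has_derivative (\<lambda>\<xi>. \<i> * complex_of_real (angular_form x \<xi> $ j) * F x $ j)) (at x)"
      using F_nth_has_derivative[OF x, of j] by (simp add: dF_eq_along[OF x] along_def)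
    have 2: "((\<lambda>y. complex_of_real (s y $ j)) has_derivative (\<lambda>\<xi>. complex_of_real (s' \<xi> $ j))) (at x)"
      using s[unfolded has_derivative_cart] by (intro has_derivative_of_real) blast
    show "((\<lambda>y. along (F y) c (s y) $ j) has_derivative
        (\<lambda>\<xi>. (along (F x) c (s' \<xi>) + along (F x) (\<i> * c) (angular_form x \<xi> * s x)) $ j)) (at x)"
      unfolding along_def
      by (rule has_derivative_eq_rhs[OF _ ext], simp, rule has_derivative_mult[OF has_derivative_mult_right[OF 2] 1])
        (simp add: algebra_simps)
  qed
  then show ?thesis
    by (rule has_derivative_transform_within_open[OF _ open_D x]) (simp add: V)
qed

text \<open>The forms \<open>angular_form\<close> are closed.  By \<open>dF_eq_along\<close>, their derivative is the second derivative of \<open>F\<close>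
up to a symmetric term.\<close>

lemma angular_deriv_sym:
  assumes x: "x \<in> D" shows "angular_deriv x \<xi> \<eta> = angular_deriv x \<eta> \<xi>"
proof -
  have "frechet_derivative (\<lambda>y. frechet_derivative F (at y) \<eta>) (at x) \<xi>
    = along (F x) \<i> (angular_deriv x \<xi> \<eta>) + along (F x) (\<i> * \<i>) (angular_form x \<xi> * angular_form x \<eta>)" for \<xi> \<eta>
    by (rule frechet_derivative_eqI[OF along_has_derivative[OF x angular_form_has_derivative[OF x]]])
      (rule dF_eq_along)
  then have "along (F x) \<i> (angular_deriv x \<xi> \<eta>) = along (F x) \<i> (angular_deriv x \<eta> \<xi>)"
    using Ck_on_2_symmetric[OF C2 open_D x, of \<eta> \<xi>] by (simp add: mult.commute)
  then show ?thesis
    using along_cong_inj[of "F x" \<i>] F_nonzero[OF x] by simp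
qed

lemma pullback_conn_along:
  assumes x: "x \<in> D" and s: "(s has_derivative s') (at x)"
    and V: "\<And>y. y \<in> D \<Longrightarrow> V y = along (F y) c (s y)"
  shows "pullback_conn fs_metric F V x \<xi>
    = along (F x) c (s' \<xi>) + along (F x) (\<i> * c) (torus_conn p (angular_form x \<xi>) (s x))"
proof -
  have "frechet_derivative V (at x) \<xi> = along (F x) c (s' \<xi>) + along (F x) (\<i> * c) (angular_form x \<xi> * s x)"
    by (rule frechet_derivative_eqI[OF along_has_derivative[OF x s V]])
  then show ?thesis
    unfolding pullback_conn_def christoffel_fs_metric dF_eq_along[OF x] V[OF x]
      fs_christoffel_along[OF x] torus_conn_def
    by (simp add: along_simps)
qed

lemma g_eq_cov: "x \<in> D \<Longrightarrow> g x \<xi> \<eta> = weighted_cov p (angular_form x \<xi>) (angular_form x \<eta>)"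
  by (simp add: g_eq dF_eq_along fs_metric_along)

lemma g_has_derivative:
  assumes x: "x \<in> D"
  shows "((\<lambda>y. g y \<xi> \<eta>) has_derivative
    (\<lambda>h. weighted_cov p (angular_form x \<xi>) (angular_deriv x h \<eta>) + weighted_cov p (angular_deriv x h \<xi>) (angular_form x \<eta>))) (at x)"
proof (rule has_derivative_transform_within_open[OF _ open_D x])
  show "((\<lambda>y. weighted_cov p (angular_form y \<xi>) (angular_form y \<eta>)) has_derivative
    (\<lambda>h. weighted_cov p (angular_form x \<xi>) (angular_deriv x h \<eta>) + weighted_cov p (angular_deriv x h \<xi>) (angular_form x \<eta>))) (at x)"
    using bounded_bilinear.FDERIV[OF bilinear_conv_bounded_bilinear[THEN iffD1, OF bilinear_weighted_cov]
        angular_form_has_derivative[OF x] angular_form_has_derivative[OF x]] .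
qed (simp add: g_eq_cov)

text \<open>The angles are flat coordinates for the induced metric, because it has constant
coefficients in terms of the closed forms \<open>angular_form\<close>.  So these forms turn the Christoffel symbols into the
derivative of \<open>angular_form\<close>.\<close>

lemma angular_form_christoffel:
  assumes x: "x \<in> D"
  shows "angular_form x (christoffel g x \<xi> \<eta>) = angular_deriv x \<xi> \<eta>"
proof -
  obtain v where v: "angular_form x v = angular_deriv x \<xi> \<eta>"
    using surj_angular_form[OF x] by (metis surjD)
  have "christoffel g x \<xi> \<eta> = v"
    unfolding christoffel_def
  proof (rule metric_dualI)
    fix w
    show "g x v w = (frechet_derivative (\<lambda>y. g y \<eta> w) (at x) \<xi> + frechet_derivative (\<lambda>y. g y \<xi> w) (at x) \<eta> -
        frechet_derivative (\<lambda>y. g y \<xi> \<eta>) (at x) w) / 2"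
      unfolding frechet_derivative_eqI[OF g_has_derivative[OF x]] g_eq_cov[OF x] v
      using angular_deriv_sym[OF x, of \<eta> \<xi>] angular_deriv_sym[OF x, of w]
      by (simp add: weighted_cov_sym[of p "angular_deriv _ _ _" "angular_form _ \<xi>"] weighted_cov_sym[of p "angular_form _ \<eta>" "angular_deriv _ _ _"])
  next
    fix v v' assume "\<And>w. g x v w = g x v' w"
    then have "weighted_cov p (angular_form x v) t = weighted_cov p (angular_form x v') t" for t
      using surj_angular_form[OF x] unfolding g_eq_cov[OF x] by (metis surjD)
    then show "v = v'"
      using weighted_cov_nondegenerate inj_angular_form[OF x] by (metis injD)
  qed
  then show ?thesis using v by simp
qed

lemma bilinear_angular_form:
  assumes "bilinear \<beta>" "x \<in> D" shows "bilinear (\<lambda>\<xi> \<eta>. \<beta> (angular_form x \<xi>) (angular_form x \<eta>))"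
  using assms linear_angular_form[OF assms(2)] linear_compose[of "angular_form x"]
  unfolding bilinear_def o_def by blast

lemma metric_trace_angular_form:
  assumes x: "x \<in> D" and \<beta>: "bilinear \<beta>"
  shows "metric_trace g x (\<lambda>\<xi> \<eta>. \<beta> (angular_form x \<xi>) (angular_form x \<eta>))
    = (\<Sum>i\<in>UNIV. frame_weight i *\<^sub>R \<beta> (frame_vec i) (frame_vec i))"
proof -
  define s where "s i = inv (angular_form x) (frame_vec i)" for i :: "'n option"
  have s: "angular_form x (s i) = frame_vec i" for i
    unfolding s_def by (rule surj_f_inv_f[OF surj_angular_form[OF x]])
  have gx: "g x = (\<lambda>\<xi> \<eta>. weighted_cov p (angular_form x \<xi>) (angular_form x \<eta>))"
    using g_eq_cov[OF x] by blast
  have "metric_trace g x (\<lambda>\<xi> \<eta>. \<beta> (angular_form x \<xi>) (angular_form x \<eta>))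
      = (\<Sum>i\<in>UNIV. frame_weight i *\<^sub>R \<beta> (angular_form x (s i)) (angular_form x (s i)))"
  proof (rule metric_trace_frame)
    show "bilinear (g x)" unfolding gx by (rule bilinear_angular_form[OF bilinear_weighted_cov x])
    show "g x u v = g x v u" for u v unfolding gx by (rule weighted_cov_sym)
    show "(\<Sum>i\<in>UNIV. (frame_weight i * g x v (s i)) *\<^sub>R s i) = v" for v
    proof (rule injD[OF inj_angular_form[OF x]])
      show "angular_form x (\<Sum>i\<in>UNIV. (frame_weight i * g x v (s i)) *\<^sub>R s i) = angular_form x v"
        using frame_reproduces[of "angular_form x v"]
        by (simp add: linear_sum[OF linear_angular_form[OF x]] linear_scale[OF linear_angular_form[OF x]] s gx)
    qed
  qed (use bilinear_angular_form[OF \<beta> x] in auto)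
  then show ?thesis by (simp add: s)
qed

lemma bilinear_along:
  assumes "bilinear b" shows "bilinear (\<lambda>s t. along w c (b s t :: real ^ 'n))"
  using assms by (auto simp: bilinear_def linear_iff along_simps)

text \<open>The derivative of \<open>angular_form\<close> in the covariant derivative of \<open>dF\<close> cancels against the Christoffel symbols of
the induced metric.\<close>

lemma second_fundamental_form_along:
  assumes x: "x \<in> D"
  shows "second_fundamental_form g fs_metric F x \<xi> \<eta> = along (F x) (- 1) (torus_conn p (angular_form x \<xi>) (angular_form x \<eta>))"
proof -
  have "pullback_conn fs_metric F (\<lambda>y. frechet_derivative F (at y) \<eta>) x \<xi>
    = along (F x) \<i> (angular_deriv x \<xi> \<eta>) + along (F x) (\<i> * \<i>) (torus_conn p (angular_form x \<xi>) (angular_form x \<eta>))"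
    by (rule pullback_conn_along[OF x angular_form_has_derivative[OF x]]) (rule dF_eq_along)
  then show ?thesis
    by (simp add: second_fundamental_form_def dF_eq_along[OF x] angular_form_christoffel[OF x])
qed

lemma tension_field_along:
  assumes x: "x \<in> D"
  shows "tension_field g fs_metric F x = along (F x) (- 1) torus_tension"
proof -
  have "tension_field g fs_metric F x
      = metric_trace g x (\<lambda>\<xi> \<eta>. along (F x) (- 1) (torus_conn p (angular_form x \<xi>) (angular_form x \<eta>)))"
    unfolding tension_field_def
    by (rule arg_cong[where f = "metric_trace g x"]) (intro ext second_fundamental_form_along[OF x])
  also have "\<dots> = along (F x) (- 1) torus_tension"
    using metric_trace_angular_form[OF x bilinear_along[OF bilinear_torus_conn]]
    by (simp add: torus_tension_def linear_sum[OF linear_along] linear_scale[OF linear_along])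
  finally show ?thesis .
qed

text \<open>The coefficients of the tension field are constant, so only the algebraic part of the connection
contributes; its two factors \<open>\<i>\<close> cancel the sign of the tension field.\<close>

lemma second_covariant_derivative_tension:
  assumes x: "x \<in> D"
  shows "second_covariant_derivative g fs_metric F (tension_field g fs_metric F) x \<xi> \<eta>
    = along (F x) 1 (torus_conn p (angular_form x \<xi>) (torus_conn p (angular_form x \<eta>) torus_tension))"
proof -
  have first: "pullback_conn fs_metric F (tension_field g fs_metric F) y \<zeta>
      = along (F y) (- \<i>) (torus_conn p (angular_form y \<zeta>) torus_tension)" if y: "y \<in> D" for y \<zeta>
    using pullback_conn_along[OF y has_derivative_const tension_field_along] by (simp add: along_simps)
  have lin: "bounded_linear (\<lambda>s. torus_conn p s torus_tension)"
    using bilinear_torus_conn[of p] by (simp add: bilinear_def linear_conv_bounded_linear)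
  have "((\<lambda>y. torus_conn p (angular_form y \<eta>) torus_tension) has_derivative
      (\<lambda>\<xi>. torus_conn p (angular_deriv x \<xi> \<eta>) torus_tension)) (at x)"
    by (rule bounded_linear.has_derivative[OF lin angular_form_has_derivative[OF x]])
  from pullback_conn_along[OF x this first, of \<xi>]
  show ?thesis
    unfolding second_covariant_derivative_def first[OF x] angular_form_christoffel[OF x] by simp
qed

text \<open>Tangent vectors are imaginary and the tension field is real, which leaves three of the five terms of the
curvature tensor.\<close>

lemma curvature_term:
  assumes x: "x \<in> D"
  shows "curvature_tensor fs_metric (F x) (frechet_derivative F (at x) \<xi>) (tension_field g fs_metric F x)
      (frechet_derivative F (at x) \<eta>)
    = along (F x) 1 (weighted_cov p (angular_form x \<eta>) (angular_form x \<xi>) *\<^sub>R torus_tension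
        + weighted_cov p (angular_form x \<eta>) torus_tension *\<^sub>R angular_form x \<xi>
        + (2 * weighted_cov p (angular_form x \<xi>) torus_tension) *\<^sub>R angular_form x \<eta>)"
  unfolding curvature_tensor_fs_metric dF_eq_along[OF x] tension_field_along[OF x]
  by (simp add: along_simps(7) fs_metric_along[OF x])
    (simp add: along_simps algebra_simps)

lemma bitension_field_along:
  assumes x: "x \<in> D"
  shows "bitension_field g fs_metric F x $ l
    = complex_of_real ((1 / p $ l - 1 / p0) * (1 / p $ l + 1 / p0 - 2 * (CARD('n) + 3))) * F x $ l"
proof -
  let ?t = torus_tension
  define lap where "lap = (\<Sum>i\<in>UNIV. frame_weight i *\<^sub>R torus_conn p (frame_vec i) (torus_conn p (frame_vec i) ?t))"
  have cc: "bilinear (\<lambda>s t. torus_conn p s (torus_conn p t ?t))"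
    using bilinear_torus_conn[of p] linear_compose[of "\<lambda>t. torus_conn p t ?t"]
    unfolding bilinear_def o_def by blast
  have cb: "bilinear (\<lambda>s t. weighted_cov p t s *\<^sub>R ?t + weighted_cov p t ?t *\<^sub>R s + (2 * weighted_cov p s ?t) *\<^sub>R t)"
    using bilinear_weighted_cov[of p] unfolding bilinear_def linear_iff
    by (auto simp: algebra_simps)
  have "- rough_laplacian g fs_metric F (tension_field g fs_metric F) x
      = metric_trace g x (\<lambda>\<xi> \<eta>. along (F x) 1 (torus_conn p (angular_form x \<xi>) (torus_conn p (angular_form x \<eta>) ?t)))"
    unfolding rough_laplacian_def minus_minus
    by (rule arg_cong[where f = "metric_trace g x"]) (intro ext second_covariant_derivative_tension[OF x])
  also have "\<dots> = along (F x) 1 lap"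
    using metric_trace_angular_form[OF x bilinear_along[OF cc]]
    by (simp add: lap_def linear_sum[OF linear_along] linear_scale[OF linear_along])
  finally have 1: "- rough_laplacian g fs_metric F (tension_field g fs_metric F) x = along (F x) 1 lap" .
  \<comment> \<open>the first term contributes \<open>n t\<close> by \<open>frame_cov_trace\<close>, the other two \<open>t\<close> and \<open>2 t\<close> by \<open>frame_reproduces\<close>\<close>
  have tr: "(\<Sum>i\<in>UNIV. frame_weight i *\<^sub>R (weighted_cov p (frame_vec i) (frame_vec i) *\<^sub>R ?t
      + weighted_cov p (frame_vec i) ?t *\<^sub>R frame_vec i
      + (2 * weighted_cov p (frame_vec i) ?t) *\<^sub>R frame_vec i)) = (CARD('n) + 3) *\<^sub>R ?t"
  proof -
    have "(\<Sum>i\<in>UNIV. frame_weight i *\<^sub>R (weighted_cov p (frame_vec i) (frame_vec i) *\<^sub>R ?t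
      + weighted_cov p (frame_vec i) ?t *\<^sub>R frame_vec i
      + (2 * weighted_cov p (frame_vec i) ?t) *\<^sub>R frame_vec i))
     = (\<Sum>i\<in>UNIV. frame_weight i * weighted_cov p (frame_vec i) (frame_vec i)) *\<^sub>R ?t
      + 3 *\<^sub>R (\<Sum>i\<in>UNIV. (frame_weight i * weighted_cov p ?t (frame_vec i)) *\<^sub>R frame_vec i)"
      unfolding scaleR_sum_left scaleR_sum_right sum.distrib[symmetric] weighted_cov_sym[of p ?t]
      by (rule sum.cong) (simp_all add: scaleR_add_right flip: scaleR_add_left)
    then show ?thesis
      unfolding frame_cov_trace frame_reproduces by (simp add: scaleR_add_left)
  qed
  have "metric_trace g x (\<lambda>\<xi> \<eta>. curvature_tensor fs_metric (F x) (frechet_derivative F (at x) \<xi>)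
       (tension_field g fs_metric F x) (frechet_derivative F (at x) \<eta>))
     = along (F x) 1 ((CARD('n) + 3) *\<^sub>R ?t)"
    unfolding curvature_term[OF x] tr[symmetric]
    by (subst metric_trace_angular_form[OF x bilinear_along[OF cb]])
      (simp add: linear_sum[OF linear_along] linear_scale[OF linear_along])
  with 1 have "bitension_field g fs_metric F x = along (F x) 1 (lap - (CARD('n) + 3) *\<^sub>R ?t)"
    by (simp add: bitension_field_def along_simps)
  then have "bitension_field g fs_metric F x $ l = complex_of_real ((lap - (CARD('n) + 3) *\<^sub>R ?t) $ l) * F x $ l"
    by (simp only: along_def vec_lambda_beta mult_1_left)
  then show ?thesis
    by (simp only: lap_def torus_bitension)
qed

end

section \<open>Charts of complex projective space\<close>

abbreviation swap :: "'n option \<Rightarrow> 'n option \<Rightarrow> 'n option" where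
  "swap k \<equiv> Transposition.transpose None k"

abbreviation chart :: "'n option \<Rightarrow> complex ^ 'n \<Rightarrow> (complex ^ ('n::finite option)) set" where
  "chart k \<equiv> \<lambda>w. hopf (sphere_lift k w)"

lemma hopf_scale:
  fixes z :: "complex ^ ('k::finite)"
  assumes c: "cmod c = 1" shows "hopf (c *s z) = hopf z"
proof -
  have "\<exists>b'. b *s z = b' *s (c *s z) \<and> cmod b' = 1" if "cmod b = 1" for b
    using that c by (intro exI[of _ "b / c"]) (auto simp: vector_smult_assoc norm_divide)
  moreover have "\<exists>b'. b *s (c *s z) = b' *s z \<and> cmod b' = 1" if "cmod b = 1" for b
    using that c by (intro exI[of _ "b * c"]) (auto simp: vector_smult_assoc norm_mult)
  ultimately show ?thesis
    unfolding hopf_def by blast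
qed

lemma hopf_eqD:
  assumes "hopf z = hopf z'" obtains c where "cmod c = 1" "z' = c *s z"
proof -
  have "z' \<in> hopf z'" unfolding hopf_def by (auto intro: exI[of _ 1] simp: vec_eq_iff)
  then show ?thesis using assms that unfolding hopf_def by auto
qed

lemma affine_coords_scale: "c \<noteq> 0 \<Longrightarrow> affine_coords k (c *s z) = affine_coords k z"
  by (simp add: affine_coords_def vec_eq_iff)

lemma affine_lift_nth_swap: "affine_lift k w $ swap k (Some j) = w $ j" "affine_lift k w $ k = 1"
  by (simp_all add: affine_lift_def)

lemma sphere_lift_scale:
  "\<exists>c. c \<noteq> 0 \<and> sphere_lift k w = complex_of_real c *s affine_lift k (w :: complex ^ ('n::finite))"
proof -
  have "affine_lift k w $ k \<noteq> 0" by (simp add: affine_lift_nth_swap)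
  then have "affine_lift k w \<noteq> 0" by auto
  then show ?thesis
    by (intro exI[of _ "inverse (norm (affine_lift k w))"])
      (simp add: sphere_lift_def vec_eq_iff, simp add: scaleR_conv_of_real)
qed

lemma affine_coords_sphere_lift: "affine_coords k (sphere_lift k w) = (w :: complex ^ ('n::finite))"
  and sphere_lift_nth_nonzero: "sphere_lift k w $ k \<noteq> 0"
proof -
  obtain c where c: "c \<noteq> 0" "sphere_lift k w = complex_of_real c *s affine_lift k w"
    using sphere_lift_scale by blast
  show "affine_coords k (sphere_lift k w) = w"
    unfolding c(2) using c(1) by (simp add: affine_coords_scale)
      (simp add: affine_coords_def vec_eq_iff affine_lift_nth_swap)
  show "sphere_lift k w $ k \<noteq> 0"
    unfolding c(2) using c(1) by (simp add: affine_lift_nth_swap)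
qed

text \<open>The affine coordinates are homogeneous of degree zero, so they are well defined on Hopf fibres.  This determines the charts and their inverses.\<close>

lemma hopf_eq_chart_iff:
  fixes z :: "complex ^ ('n::finite option)"
  assumes z: "norm z = 1"
  shows "hopf z = chart k w \<longleftrightarrow> z $ k \<noteq> 0 \<and> w = affine_coords k z"
proof
  assume "hopf z = chart k w"
  then obtain c where c: "cmod c = 1" "z = c *s sphere_lift k w"
    using hopf_eqD by metis
  then have "c \<noteq> 0" by auto
  then show "z $ k \<noteq> 0 \<and> w = affine_coords k z"
    using c by (simp add: affine_coords_scale affine_coords_sphere_lift sphere_lift_nth_nonzero)
next
  assume *: "z $ k \<noteq> 0 \<and> w = affine_coords k z"
  then show "hopf z = chart k w"
    using sphere_lift_coords[of z k] z by (simp add: hopf_scale norm_divide)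
qed

lemma inj_chart: "inj (chart k :: complex ^ 'n \<Rightarrow> (complex ^ ('n::finite option)) set)"
  by (rule injI) (simp add: hopf_eq_chart_iff norm_sphere_lift affine_coords_sphere_lift)

lemma chart_inverse:
  fixes z :: "complex ^ ('n::finite option)"
  assumes "norm z = 1" "z $ k \<noteq> 0"
  shows "the_inv_into UNIV (chart k) (hopf z) = affine_coords k z"
  using assms hopf_eq_chart_iff[of z k] by (intro the_inv_into_f_eq[OF inj_chart]) auto

lemma sum_UNIV_swap:
  fixes f :: "'n::finite option \<Rightarrow> 'b::comm_monoid_add"
  shows "(\<Sum>i\<in>UNIV. f i) = f k + (\<Sum>j\<in>UNIV. f (swap k (Some j)))"
  using sum_UNIV_transpose_None[of "\<lambda>i. f (swap k i)" k] by simp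

section \<open>The torus in its affine charts\<close>

locale clifford_torus =
  fixes a :: "'n::finite option \<Rightarrow> real"
  assumes a_pos: "\<And>i. a i > 0" and a_sphere: "(\<Sum>i\<in>UNIV. (a i)\<^sup>2) = 1"
begin

definition radii :: "'n option \<Rightarrow> real ^ 'n" where
  "radii k = (\<chi> j. a (swap k (Some j)) / a k)"

lemma radii_norm: "1 + radii k \<bullet> radii k = 1 / (a k)\<^sup>2"
proof -
  have "1 + radii k \<bullet> radii k = ((a k)\<^sup>2 + (\<Sum>j\<in>UNIV. (a (swap k (Some j)))\<^sup>2)) / (a k)\<^sup>2"
    using a_pos[of k]
    by (simp add: radii_def inner_vec_def add_divide_distrib sum_divide_distrib power2_eq_square)
  then show ?thesis
    using a_sphere sum_UNIV_swap[of "\<lambda>i. (a i)\<^sup>2" k] by simp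
qed

lemma torus_nth_nonzero: "z \<in> torus a \<Longrightarrow> z $ i \<noteq> 0"
  using a_pos[of i] by (auto simp: torus_def dest!: spec[of _ i])

lemma norm_torus: "z \<in> torus a \<Longrightarrow> norm z = 1"
  using a_sphere by (simp add: norm_vec_def L2_set_def torus_def)

text \<open>The point is that the moduli of the affine coordinates of a point of the torus are fixed; in particular no
coordinate vanishes, and every chart contains the whole torus.\<close>

lemma submanifold_torus_immersion:
  fixes x :: "real ^ 'n \<Rightarrow> (complex ^ ('n option)) set"
  assumes M: "(U, x, g) \<in> submanifold complex_projective_space (hopf ` torus a)"
  shows "coord_dom U x (\<lambda>p. p) UNIV (chart k) = U"
    and "open (coord_dom U x (\<lambda>p. p) UNIV (chart k))"
    and "smooth_on (coord_map x (\<lambda>p. p) UNIV (chart k)) (coord_dom U x (\<lambda>p. p) UNIV (chart k))"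
    and "torus_immersion (coord_map x (\<lambda>p. p) UNIV (chart k)) U (radii k) g"
proof -
  have mem: "(UNIV, chart k, fubini_study_coords k) \<in> complex_projective_space"
    by (auto simp: complex_projective_space_def)
  have xS: "x ` U \<subseteq> hopf ` torus a" and iso: "isometric_immersion {(U, \<lambda>u. u, g)} complex_projective_space x"
    using M by (auto simp: submanifold_def)
  have z: "\<exists>z\<in>torus a. x u = hopf z" if "u \<in> U" for u
    using xS that by auto
  show dom: "coord_dom U x (\<lambda>p. p) UNIV (chart k) = U"
    using z hopf_eq_chart_iff[OF norm_torus, of _ k] torus_nth_nonzero
    unfolding coord_dom_def by fastforce
  have dom': "coord_dom U (\<lambda>u. u) x UNIV (chart k) = U"
    using dom by (simp add: coord_dom_def)
  have map: "coord_map (\<lambda>u. u) x UNIV (chart k) = coord_map x (\<lambda>p. p) UNIV (chart k)"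
    by (simp add: coord_map_def)
  let ?F = "coord_map x (\<lambda>p. p) UNIV (chart k)"
  have op: "open U" and sm: "smooth_on ?F U"
    using iso mem unfolding isometric_immersion_def smooth_map_def by (auto simp: dom' map)
  then show "open (coord_dom U x (\<lambda>p. p) UNIV (chart k))"
    "smooth_on ?F (coord_dom U x (\<lambda>p. p) UNIV (chart k))"
    by (simp_all only: dom)
  have im: "inj (frechet_derivative ?F (at u)) \<and>
      (\<forall>\<xi> \<eta>. g u \<xi> \<eta> = fs_metric (?F u) (frechet_derivative ?F (at u) \<xi>) (frechet_derivative ?F (at u) \<eta>))"
    if "u \<in> U" for u
    using iso mem that unfolding isometric_immersion_def Let_def
    by (fastforce simp: dom' map fubini_study_coords_eq)
  show "torus_immersion ?F U (radii k) g"
  proof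
    show "Ck_on 2 ?F U" using sm by (simp add: smooth_on_def)
    show "radii k $ j > 0" for j using a_pos by (simp add: radii_def)
    show "cmod (?F u $ j) = radii k $ j" if u: "u \<in> U" for u j
    proof -
      obtain z where z: "z \<in> torus a" "x u = hopf z" using z u by blast
      have "?F u = affine_coords k z"
        unfolding coord_map_def z(2) by (rule chart_inverse[OF norm_torus[OF z(1)] torus_nth_nonzero[OF z(1)]])
      then show ?thesis
        using z(1) by (simp add: affine_coords_def radii_def torus_def norm_divide)
    qed
  qed (use op im in auto)
qed

lemma bitension_factor:
  assumes "torus_immersion F D (radii k) g" "u \<in> D"
  shows "bitension_field g fs_metric F u = 0 \<longleftrightarrow>
    (\<forall>j. (1 / (a (swap k (Some j)))\<^sup>2 - 1 / (a k)\<^sup>2)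
      * (1 / (a (swap k (Some j)))\<^sup>2 + 1 / (a k)\<^sup>2 - 2 * (CARD('n) + 3)) = 0)"
proof -
  interpret torus_immersion F D "radii k" g by (rule assms)
  have "p $ j = (a (swap k (Some j)))\<^sup>2" for j
    using a_pos[of k] by (simp add: p_def radii_norm) (simp add: radii_def power_divide)
  moreover have "p0 = (a k)\<^sup>2"
    by (simp add: p0_def radii_norm)
  ultimately show ?thesis
    using bitension_field_along[OF assms(2)] F_nonzero[OF assms(2)]
    by (simp add: vec_eq_iff del: of_real_mult of_real_diff of_real_add)
qed

section \<open>Angular parametrizations of the torus\<close>

text \<open>Up to the circle action, a point of the torus is determined by the angles relative to its coordinate \<open>None\<close>, whose
own angle is therefore set to 0.\<close>

definition angles :: "real ^ 'n \<Rightarrow> 'n option \<Rightarrow> real" where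
  "angles u i = (case i of None \<Rightarrow> 0 | Some j \<Rightarrow> u $ j)"

definition torus_param :: "complex ^ ('n option) \<Rightarrow> real ^ 'n \<Rightarrow> complex ^ ('n option)" where
  "torus_param z u = (\<chi> i. z $ i * cis (angles u i))"

text \<open>The angles of the affine coordinates in the chart \<open>k\<close>, which are quotients by the coordinate \<open>k\<close>.\<close>

definition rel_angles :: "'n option \<Rightarrow> real ^ 'n \<Rightarrow> real ^ 'n" where
  "rel_angles k u = (\<chi> j. angles u (swap k (Some j)) - angles u k)"

text \<open>The coordinate expressions of the parametrization by angles.  The directional derivatives of such a map are of
the same form, with other constants \<open>c\<close>, which gives smoothness by induction.\<close>

definition cis_map :: "complex ^ 'n \<Rightarrow> (real ^ 'n \<Rightarrow> real ^ 'n) \<Rightarrow> real ^ 'n \<Rightarrow> complex ^ 'n" where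
  "cis_map c L u = (\<chi> j. c $ j * cis (L u $ j))"

lemma linear_rel_angles: "linear (rel_angles k)"
  by (rule linearI) (auto simp: rel_angles_def angles_def vec_eq_iff algebra_simps split: option.split)

lemma cis_map_has_derivative:
  assumes "linear L"
  shows "(cis_map c L has_derivative (\<lambda>h. along (cis_map c L u) \<i> (L h))) (at u)"
  unfolding has_derivative_cart
proof
  fix j
  have "((\<lambda>u. L u $ j) has_derivative (\<lambda>h. L h $ j)) (at u)"
    using assms linear_imp_has_derivative[of L "at u"] has_derivative_cart by blast
  from has_derivative_mult_right[OF has_derivative_cis[OF this], of "c $ j"]
  show "((\<lambda>u. cis_map c L u $ j) has_derivative (\<lambda>h. along (cis_map c L u) \<i> (L h) $ j)) (at u)"
    by (simp add: cis_map_def along_def scaleR_conv_of_real mult_ac)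
qed

lemma cis_map_differentiable: "linear L \<Longrightarrow> cis_map c L differentiable (at u)"
  by (rule differentiableI[OF cis_map_has_derivative])

lemma Ck_on_cis_map:
  assumes L: "linear L" shows "Ck_on m (cis_map c L) S"
proof (induction m arbitrary: c)
  case 0
  show ?case
    by (simp add: cis_map_differentiable[OF L] continuous_at_imp_continuous_on differentiable_imp_continuous_within)
next
  case (Suc m)
  have "(\<lambda>u. frechet_derivative (cis_map c L) (at u) v) = cis_map (\<chi> j. c $ j * \<i> * complex_of_real (L v $ j)) L" for v
    by (auto simp: fun_eq_iff frechet_derivative_eqI[OF cis_map_has_derivative[OF L]] cis_map_def along_def vec_eq_iff)
  then show ?case
    using Suc cis_map_differentiable[OF L] by auto
qed

lemma torus_param_torus: "z \<in> torus a \<Longrightarrow> torus_param z u \<in> torus a"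
  by (simp add: torus_def torus_param_def norm_mult)

lemma affine_coords_torus_param:
  "affine_coords k (torus_param z u) = cis_map (affine_coords k z) (rel_angles k) u"
  by (simp add: affine_coords_def torus_param_def cis_map_def rel_angles_def vec_eq_iff flip: cis_divide)

lemma inj_rel_angles: "inj (rel_angles k)"
proof (rule injI)
  fix u v assume eq: "rel_angles k u = rel_angles k v"
  have d: "angles u i - angles u k = angles v i - angles v k" for i
  proof (cases "swap k i")
    case None
    then have "i = k" by (metis transpose_apply_first transpose_involutory)
    then show ?thesis by simp
  next
    case (Some j)
    then have "i = swap k (Some j)" by (metis transpose_involutory)
    then show ?thesis using eq by (simp add: rel_angles_def vec_eq_iff)
  qed
  have "angles u k = angles v k" using d[of None] by (simp add: angles_def)
  then have "angles u (Some j) = angles v (Some j)" for j using d[of "Some j"] by simp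
  then show "u = v" by (simp add: angles_def vec_eq_iff)
qed

text \<open>The covariance form over all homogeneous coordinates.  It is invariant under addition of a constant to
all angles, so passing to the angles relative to any coordinate \<open>k\<close> does not change it.  For this reason the
charts all induce the same metric.\<close>

definition torus_metric :: "real ^ 'n \<Rightarrow> real ^ 'n \<Rightarrow> real ^ 'n \<Rightarrow> real" where
  "torus_metric u \<xi> \<eta> = (\<Sum>i\<in>UNIV. (a i)\<^sup>2 * angles \<xi> i * angles \<eta> i)
     - (\<Sum>i\<in>UNIV. (a i)\<^sup>2 * angles \<xi> i) * (\<Sum>i\<in>UNIV. (a i)\<^sup>2 * angles \<eta> i)"

lemma torus_metric_eq:
  fixes k :: "'n option" and z :: "complex ^ ('n option)"
  assumes z: "z \<in> torus a"
  defines "F \<equiv> cis_map (affine_coords k z) (rel_angles k)"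
  shows "inj (frechet_derivative F (at u))"
    and "torus_metric u \<xi> \<eta> = fs_metric (F u) (frechet_derivative F (at u) \<xi>) (frechet_derivative F (at u) \<eta>)"
proof -
  define gk where "gk u \<xi> \<eta> = fs_metric (F u) (frechet_derivative F (at u) \<xi>) (frechet_derivative F (at u) \<eta>)" for u \<xi> \<eta>
  have dF: "frechet_derivative F (at u) \<xi> = along (F u) \<i> (rel_angles k \<xi>)" for u \<xi>
    unfolding F_def by (rule frechet_derivative_eqI[OF cis_map_has_derivative[OF linear_rel_angles]])
  have cF: "cmod (F u $ j) = radii k $ j" for u j
    using z by (simp add: F_def cis_map_def norm_mult affine_coords_def radii_def torus_def norm_divide)
  have rp: "radii k $ j > 0" for j using a_pos by (simp add: radii_def)
  have Fnz: "F u $ j \<noteq> 0" for u j using cF[of u j] rp[of j] by auto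
  have inj: "inj (frechet_derivative F (at u))" for u
  proof (rule injI)
    fix v w assume "frechet_derivative F (at u) v = frechet_derivative F (at u) w"
    then have "rel_angles k v = rel_angles k w"
      unfolding dF using along_cong_inj[of "F u" \<i>] Fnz by simp
    then show "v = w" using inj_rel_angles by (metis injD)
  qed
  then show "inj (frechet_derivative F (at u))" .
  interpret torus_immersion F UNIV "radii k" gk
    using Ck_on_cis_map[OF linear_rel_angles] cF rp inj
    by unfold_locales (auto simp: F_def gk_def)
  have angular_form: "angular_form u \<xi> = rel_angles k \<xi>" for \<xi>
  proof (rule along_cong_inj[of "F u" \<i>])
    show "along (F u) \<i> (angular_form u \<xi>) = along (F u) \<i> (rel_angles k \<xi>)"
      using dF_eq_along[of u] dF by simp
  qed (use Fnz in auto)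
  have pj: "p $ j = (a (swap k (Some j)))\<^sup>2" for j
    using a_pos[of k] by (simp add: p_def radii_norm) (simp add: radii_def power_divide)
  define A B where "A = angles \<xi>" and "B = angles \<eta>"
  have mean: "p \<bullet> rel_angles k \<zeta> = (\<Sum>i\<in>UNIV. (a i)\<^sup>2 * angles \<zeta> i) - angles \<zeta> k" for \<zeta>
  proof -
    have "p \<bullet> rel_angles k \<zeta> = (\<Sum>i\<in>UNIV. (a i)\<^sup>2 * (angles \<zeta> i - angles \<zeta> k))"
      by (simp add: sum_UNIV_swap[of _ k] inner_vec_def pj rel_angles_def)
    also have "\<dots> = (\<Sum>i\<in>UNIV. (a i)\<^sup>2 * angles \<zeta> i) - (\<Sum>i\<in>UNIV. (a i)\<^sup>2) * angles \<zeta> k"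
      by (simp add: right_diff_distrib sum_subtractf sum_distrib_right)
    finally show ?thesis using a_sphere by simp
  qed
  have "p \<bullet> (rel_angles k \<xi> * rel_angles k \<eta>) = (\<Sum>i\<in>UNIV. (a i)\<^sup>2 * ((A i - A k) * (B i - B k)))"
    by (simp add: sum_UNIV_swap[of _ k] inner_vec_def pj rel_angles_def A_def B_def)
  also have "\<dots> = (\<Sum>i\<in>UNIV. (a i)\<^sup>2 * A i * B i - (a i)\<^sup>2 * A i * B k - (a i)\<^sup>2 * B i * A k + (a i)\<^sup>2 * (A k * B k))"
    by (rule sum.cong) (simp_all add: algebra_simps)
  also have "\<dots> = (\<Sum>i\<in>UNIV. (a i)\<^sup>2 * A i * B i) - (\<Sum>i\<in>UNIV. (a i)\<^sup>2 * A i) * B k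
      - (\<Sum>i\<in>UNIV. (a i)\<^sup>2 * B i) * A k + (\<Sum>i\<in>UNIV. (a i)\<^sup>2) * (A k * B k)"
    by (simp add: sum.distrib sum_subtractf sum_distrib_right)
  finally have "gk u \<xi> \<eta> = torus_metric u \<xi> \<eta>"
    unfolding g_eq_cov[of u, simplified] angular_form weighted_cov_def mean torus_metric_def a_sphere
    by (simp add: A_def B_def algebra_simps)
  then show "torus_metric u \<xi> \<eta> = fs_metric (F u) (frechet_derivative F (at u) \<xi>) (frechet_derivative F (at u) \<eta>)"
    by (simp add: gk_def)
qed

definition angle_box :: "(real ^ 'n) set" where
  "angle_box = {u. \<forall>j. \<bar>u $ j\<bar> < pi}"

lemma open_angle_box: "open angle_box"
proof -
  have "angle_box = (\<Inter>j. {u. \<bar>u $ j\<bar> < pi})" by (auto simp: angle_box_def)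
  moreover have "open {u :: real ^ 'n. \<bar>u $ j\<bar> < pi}" for j
    by (intro open_Collect_less continuous_intros)
  then have "open (\<Inter>j. {u :: real ^ 'n. \<bar>u $ j\<bar> < pi})"
    by (intro open_INT) auto
  ultimately show ?thesis by (simp only:)
qed

lemma cis_notin_nonpos: "\<bar>t\<bar> < pi \<Longrightarrow> cis t \<notin> \<real>\<^sub>\<le>\<^sub>0"
proof
  assume t: "\<bar>t\<bar> < pi" and "cis t \<in> \<real>\<^sub>\<le>\<^sub>0"
  then have "Re (cis t) \<le> 0" "Im (cis t) = 0" by (auto simp: complex_nonpos_Reals_iff)
  then have c: "cis t = complex_of_real (Re (cis t))" "Re (cis t) \<le> 0" by (simp_all add: complex_eq_iff)
  have "cis t \<noteq> 0" by simp
  then have "Re (cis t) < 0" using c by (metis less_eq_real_def of_real_0)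
  then have "Arg (cis t) = pi" using c Arg_of_real by metis
  moreover have "Arg (cis t) = t" using t by (intro Arg_cis) auto
  ultimately show False using t by simp
qed

lemma rel_angles_None: "rel_angles None u = u"
  by (simp add: rel_angles_def angles_def vec_eq_iff)

text \<open>The points whose components have, relative to those of \<open>c\<close>, angles in \<open>W\<close>.  The moduli of the components are free, which makes this
set open in the ambient space.\<close>

definition polar_nbhd :: "complex ^ 'n \<Rightarrow> (real ^ 'n) set \<Rightarrow> (complex ^ 'n) set" where
  "polar_nbhd c W = {w. (\<forall>j. w $ j / c $ j \<notin> \<real>\<^sub>\<le>\<^sub>0) \<and> (\<chi> j. Arg (w $ j / c $ j)) \<in> W}"

lemma open_polar_nbhd:
  assumes W: "open W" shows "open (polar_nbhd c W)"
proof -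
  let ?Q = "{w. \<forall>j. w $ j / c $ j \<notin> \<real>\<^sub>\<le>\<^sub>0}"
  have "?Q = (\<Inter>j. (\<lambda>w. w $ j / c $ j) -` (- \<real>\<^sub>\<le>\<^sub>0))" by auto
  moreover have "open ((\<lambda>w. w $ j / c $ j) -` (- \<real>\<^sub>\<le>\<^sub>0))" for j
    unfolding divide_inverse
    by (intro open_vimage continuous_intros) (simp add: closed_nonpos_Reals_complex open_Compl)
  ultimately have Q: "open ?Q" by auto
  have "continuous_on ?Q (\<lambda>w. \<chi> j. Arg (w $ j / c $ j))"
    unfolding divide_inverse
    by (intro continuous_on_vec_lambda continuous_on_Arg' continuous_intros) auto
  from continuous_open_preimage[OF this Q W]
  show ?thesis by (simp add: polar_nbhd_def vimage_def Int_def)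
qed

lemma manifold_open_chart_image:
  assumes Q: "open (Q :: (complex ^ 'n) set)"
  shows "manifold_open complex_projective_space (chart k ` Q)"
  unfolding manifold_open_def
proof
  show "chart k ` Q \<subseteq> points complex_projective_space"
    by (auto simp: points_def complex_projective_space_def)
  have "open {w. chart l w \<in> chart k ` Q}" for l :: "'n option"
  proof -
    have eq: "{w. chart l w \<in> chart k ` Q}
      = {w. sphere_lift l w $ k \<noteq> 0} \<inter> (\<lambda>w. affine_coords k (sphere_lift l w)) -` Q"
      using hopf_eq_chart_iff[OF norm_sphere_lift, of l _ k] by (auto simp: image_iff)
    have c: "continuous_on S (sphere_lift l)" for S
      by (simp add: continuous_at_imp_continuous_on differentiable_imp_continuous_within sphere_lift_differentiable)
    have "open {w. sphere_lift l w $ k \<noteq> 0}"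
      by (intro open_Collect_neq continuous_intros c)
    moreover have "continuous_on {w. sphere_lift l w $ k \<noteq> 0} (\<lambda>w. affine_coords k (sphere_lift l w))"
      unfolding affine_coords_def by (intro continuous_intros c) auto
    ultimately show ?thesis
      unfolding eq using Q continuous_open_preimage by blast
  qed
  then show "\<forall>(U, x, g)\<in>complex_projective_space. open {u \<in> U. x u \<in> chart k ` Q}"
    by (auto simp: complex_projective_space_def)
qed

text \<open>The parametrization \<open>torus_param z\<close> starts at \<open>z\<close>, so that the angles on \<open>angle_box\<close> are principal values and
\<open>Arg\<close> is a continuous inverse.  The relatively open image of \<open>W\<close> is cut out by the neighbourhood \<open>polar_nbhd\<close>.\<close>

lemma torus_param_submanifold:
  assumes z: "z \<in> torus a"
  shows "(angle_box, \<lambda>u. hopf (torus_param z u), torus_metric)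
    \<in> submanifold complex_projective_space (hopf ` torus a)"
proof -
  let ?x = "\<lambda>u. hopf (torus_param z u)"
  let ?F = "\<lambda>k. cis_map (affine_coords k z) (rel_angles k)"
  let ?c = "affine_coords None z"
  have nz: "torus_param z u $ k \<noteq> 0" for u k
    using torus_nth_nonzero[OF torus_param_torus[OF z]] .
  have nrm: "norm (torus_param z u) = 1" for u
    using norm_torus[OF torus_param_torus[OF z]] .
  have chart_x: "?x u = chart k w \<longleftrightarrow> w = ?F k u" for u k w
    using hopf_eq_chart_iff[OF nrm] nz by (simp add: affine_coords_torus_param)
  have dom: "coord_dom angle_box (\<lambda>u. u) ?x UNIV (chart k) = angle_box" for k
    using chart_x by (auto simp: coord_dom_def)
  have map: "coord_map (\<lambda>u. u) ?x UNIV (chart k) = ?F k" for k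
    by (simp add: coord_map_def chart_inverse nrm nz affine_coords_torus_param)
  have cnz: "?c $ j \<noteq> 0" for j
    using torus_nth_nonzero[OF z] by (simp add: affine_coords_def)
  have FN: "?F None u $ j / ?c $ j = cis (u $ j)" for u j
    using cnz by (simp add: cis_map_def rel_angles_None)
  have Arg_FN: "Arg (?F None u $ j / ?c $ j) = u $ j" if "u \<in> angle_box" for u j
    unfolding FN using that by (intro Arg_cis) (auto simp: angle_box_def abs_less_iff minus_less_iff less_imp_le)
  have xS: "?x ` W \<subseteq> hopf ` torus a" for W
    using torus_param_torus[OF z] by blast
  have inj: "inj_on ?x angle_box"
  proof (rule inj_onI)
    fix u v assume u: "u \<in> angle_box" "v \<in> angle_box" and eq: "?x u = ?x v"
    then have "?F None u = ?F None v" using chart_x by metis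
    then show "u = v" using Arg_FN u by (metis vec_eq_iff)
  qed
  have sm: "smooth_map {(angle_box, \<lambda>u. u, torus_metric)} complex_projective_space ?x"
    unfolding smooth_map_def
  proof
    show "?x ` points {(angle_box, \<lambda>u. u, torus_metric)} \<subseteq> points complex_projective_space"
      using nrm by (auto simp: points_complex_projective_space)
    show "\<forall>(U, x, g)\<in>{(angle_box, \<lambda>u. u, torus_metric)}. \<forall>(V, y, h)\<in>complex_projective_space.
        open (coord_dom U x ?x V y) \<and> smooth_on (coord_map x ?x V y) (coord_dom U x ?x V y)"
      by (auto simp: complex_projective_space_def dom map open_angle_box smooth_on_def
          Ck_on_cis_map linear_rel_angles)
  qed
  have iso: "isometric_immersion {(angle_box, \<lambda>u. u, torus_metric)} complex_projective_space ?x"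
    unfolding isometric_immersion_def
    using sm torus_metric_eq[OF z]
    by (auto simp: complex_projective_space_def dom map fubini_study_coords_eq Let_def)
  have homeo: "\<exists>G. manifold_open complex_projective_space G \<and> ?x ` W = hopf ` torus a \<inter> G"
    if W: "open W" "W \<subseteq> angle_box" for W
  proof (intro exI[of _ "chart None ` polar_nbhd ?c W"] conjI)
    show "manifold_open complex_projective_space (chart None ` polar_nbhd ?c W)"
      by (rule manifold_open_chart_image[OF open_polar_nbhd[OF W(1)]])
    have sub: "?x u \<in> chart None ` polar_nbhd ?c W" if u: "u \<in> W" for u
    proof -
      have ub: "u \<in> angle_box" using u W by auto
      have "(\<chi> j. Arg (?F None u $ j / ?c $ j)) = u" by (simp add: vec_eq_iff Arg_FN[OF ub])
      moreover have "?F None u $ j / ?c $ j \<notin> \<real>\<^sub>\<le>\<^sub>0" for j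
        unfolding FN using ub by (intro cis_notin_nonpos) (auto simp: angle_box_def)
      ultimately have "?F None u \<in> polar_nbhd ?c W"
        using u unfolding polar_nbhd_def by simp
      moreover have "?x u = chart None (?F None u)" using chart_x by blast
      ultimately show ?thesis by blast
    qed
    have sup: "s \<in> ?x ` W" if s: "s \<in> hopf ` torus a" "s \<in> chart None ` polar_nbhd ?c W" for s
    proof -
      obtain z' q where z': "z' \<in> torus a" "s = hopf z'" and q: "q \<in> polar_nbhd ?c W" "s = chart None q"
        using s by blast
      have qz: "q = affine_coords None z'"
        using hopf_eq_chart_iff[OF norm_torus[OF z'(1)]] z' q by metis
      define u :: "real ^ 'n" where "u = (\<chi> j. Arg (q $ j / ?c $ j))"
      have uW: "u \<in> W" using q by (simp add: polar_nbhd_def u_def)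
      have "?F None u $ j = q $ j" for j
      proof -
        have "cmod (q $ j) = cmod (?c $ j)" "q $ j \<noteq> 0"
          using z z'(1) torus_nth_nonzero[OF z'(1)]
          by (simp_all add: qz affine_coords_def torus_def norm_divide)
        then have "cis (u $ j) = q $ j / ?c $ j"
          using cnz[of j] by (simp add: u_def cis_Arg sgn_div_norm norm_divide)
        then show ?thesis using FN[of u j] cnz[of j] by simp
      qed
      then have "?F None u = q" by (simp add: vec_eq_iff)
      then have "?x u = s" using chart_x q(2) by metis
      then show ?thesis using uW by blast
    qed
    show "?x ` W = hopf ` torus a \<inter> chart None ` polar_nbhd ?c W"
      using sub sup xS[of W] by blast
  qed
  show ?thesis
    unfolding submanifold_def using open_angle_box inj xS iso homeo by auto
qed

lemma points_torus_submanifold: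
  "points (submanifold complex_projective_space (hopf ` torus a) :: (real ^ 'n, _) riem_manifold)
    = hopf ` torus a"
proof
  show "points (submanifold complex_projective_space (hopf ` torus a) :: (real ^ 'n, _) riem_manifold)
    \<subseteq> hopf ` torus a"
    by (auto simp: points_def submanifold_def)
  show "hopf ` torus a
    \<subseteq> points (submanifold complex_projective_space (hopf ` torus a) :: (real ^ 'n, _) riem_manifold)"
  proof
    fix s assume "s \<in> hopf ` torus a"
    then obtain z where z: "z \<in> torus a" "s = hopf z" by blast
    have "(0 :: real ^ 'n) \<in> angle_box" by (simp add: angle_box_def)
    moreover have "torus_param z 0 = z"
      by (auto simp: torus_param_def angles_def vec_eq_iff split: option.split)
    ultimately have "s \<in> (\<lambda>u. hopf (torus_param z u)) ` angle_box"
      using z(2) by (metis image_eqI)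
    then show "s \<in> points (submanifold complex_projective_space (hopf ` torus a) :: (real ^ 'n, _) riem_manifold)"
      unfolding points_def using torus_param_submanifold[OF z(1)] by blast
  qed
qed

section \<open>The criterion\<close>

lemma torus_nonempty: "torus a \<noteq> {}"
proof -
  have "(\<chi> i. complex_of_real (a i)) \<in> torus a"
    using a_pos by (simp add: torus_def less_imp_le)
  then show ?thesis by blast
qed

lemma biharmonic_torus_iff:
  "biharmonic_submanifold TYPE(real ^ 'n) complex_projective_space (hopf ` torus a) \<longleftrightarrow>
    (\<forall>k j. (1 / (a (swap k (Some j)))\<^sup>2 - 1 / (a k)\<^sup>2)
      * (1 / (a (swap k (Some j)))\<^sup>2 + 1 / (a k)\<^sup>2 - 2 * (CARD('n) + 3)) = 0)" (is "_ \<longleftrightarrow> ?R")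
proof -
  let ?N = "complex_projective_space :: (complex ^ 'n, _) riem_manifold"
  let ?M = "submanifold ?N (hopf ` torus a) :: (real ^ 'n, _) riem_manifold"
  have sm: "smooth_map ?M ?N (\<lambda>p. p)"
    unfolding smooth_map_def
  proof
    show "(\<lambda>p. p) ` points ?M \<subseteq> points ?N"
      using norm_torus by (auto simp: points_torus_submanifold points_complex_projective_space)
    show "\<forall>(U, x, g)\<in>?M. \<forall>(V, y, h)\<in>?N.
        open (coord_dom U x (\<lambda>p. p) V y) \<and> smooth_on (coord_map x (\<lambda>p. p) V y) (coord_dom U x (\<lambda>p. p) V y)"
      using submanifold_torus_immersion(2,3) by (auto simp: complex_projective_space_def)
  qed
  have bi: "bitension_field g (fubini_study_coords k) (coord_map x (\<lambda>p. p) UNIV (chart k)) u = 0 \<longleftrightarrow>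
     (\<forall>j. (1 / (a (swap k (Some j)))\<^sup>2 - 1 / (a k)\<^sup>2)
      * (1 / (a (swap k (Some j)))\<^sup>2 + 1 / (a k)\<^sup>2 - 2 * (CARD('n) + 3)) = 0)"
    if "(U, x, g) \<in> ?M" "u \<in> U" for U x g k u
    unfolding fubini_study_coords_eq
    by (rule bitension_factor[OF submanifold_torus_immersion(4)[OF that(1)] that(2)])
  have "biharmonic_map ?M ?N (\<lambda>p. p) \<longleftrightarrow>
     (\<forall>(U, x, g)\<in>?M. \<forall>k. \<forall>u\<in>U.
        bitension_field g (fubini_study_coords k) (coord_map x (\<lambda>p. p) UNIV (chart k)) u = 0)"
    unfolding biharmonic_map_def using sm submanifold_torus_immersion(1)
    by (fastforce simp: complex_projective_space_def)
  also have "\<dots> \<longleftrightarrow> ?R"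
  proof
    assume ?R
    then show "\<forall>(U, x, g)\<in>?M. \<forall>k. \<forall>u\<in>U.
        bitension_field g (fubini_study_coords k) (coord_map x (\<lambda>p. p) UNIV (chart k)) u = 0"
      using bi by blast
  next
    assume *: "\<forall>(U, x, g)\<in>?M. \<forall>k. \<forall>u\<in>U.
        bitension_field g (fubini_study_coords k) (coord_map x (\<lambda>p. p) UNIV (chart k)) u = 0"
    obtain z where z: "z \<in> torus a" using torus_nonempty by blast
    have "(0 :: real ^ 'n) \<in> angle_box" by (simp add: angle_box_def)
    then show ?R
      using bi[OF torus_param_submanifold[OF z]] * torus_param_submanifold[OF z] by blast
  qed
  finally show ?thesis
    unfolding biharmonic_submanifold_def by (simp add: points_torus_submanifold)
qed

text \<open>With \<open>X i = 1 / (a i)\<^sup>2\<close> the factors are the differences of the values of \<open>\<phi> = X\<^sup>2 - c X\<close>.  The weighted average of \<open>\<phi>\<close> is known,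
so \<open>\<phi>\<close> is constant if and only if it equals this average.\<close>

lemma torus_condition_iff:
  fixes c :: real
  defines "d \<equiv> (\<Sum>j\<in>UNIV. 1 / (a j)\<^sup>2)"
  shows "(\<forall>k j. (1 / (a (swap k (Some j)))\<^sup>2 - 1 / (a k)\<^sup>2)
      * (1 / (a (swap k (Some j)))\<^sup>2 + 1 / (a k)\<^sup>2 - c) = 0)
    \<longleftrightarrow> (\<forall>i. a i * d - 1 / (a i) ^ 3 = c * ((CARD('n) + 1) * a i - 1 / a i))"
proof -
  define X where "X i = 1 / (a i)\<^sup>2" for i
  define \<phi> where "\<phi> i = (X i)\<^sup>2 - c * X i" for i
  have aX: "(a i)\<^sup>2 * X i = 1" for i using a_pos[of i] by (simp add: X_def)
  have fac: "(X i - X k) * (X i + X k - c) = \<phi> i - \<phi> k" for i k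
    by (simp add: \<phi>_def power2_eq_square algebra_simps)
  have off: "(\<forall>k j. \<phi> (swap k (Some j)) = \<phi> k) \<longleftrightarrow> (\<forall>i k. \<phi> i = \<phi> k)"
  proof
    assume *: "\<forall>k j. \<phi> (swap k (Some j)) = \<phi> k"
    have "\<phi> i = \<phi> None" for i
      using *[rule_format, of None] by (cases i) auto
    then show "\<forall>i k. \<phi> i = \<phi> k" by metis
  qed auto
  have "(\<Sum>i\<in>UNIV. (a i)\<^sup>2 * \<phi> i) = d - c * (CARD('n) + 1)"
  proof -
    have "(a i)\<^sup>2 * \<phi> i = X i - c" for i
    proof -
      have "(a i)\<^sup>2 * \<phi> i = ((a i)\<^sup>2 * X i) * X i - c * ((a i)\<^sup>2 * X i)"
        by (simp add: \<phi>_def power2_eq_square algebra_simps)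
      then show ?thesis by (simp add: aX)
    qed
    then have "(\<Sum>i\<in>UNIV. (a i)\<^sup>2 * \<phi> i) = (\<Sum>i\<in>UNIV. X i - c)"
      by (simp only:)
    then show ?thesis
      by (simp add: sum_subtractf d_def X_def card_option algebra_simps)
  qed
  then have const: "(\<forall>i k. \<phi> i = \<phi> k) \<longleftrightarrow> (\<forall>i. \<phi> i = d - c * (CARD('n) + 1))"
  proof -
    assume s: "(\<Sum>i\<in>UNIV. (a i)\<^sup>2 * \<phi> i) = d - c * (CARD('n) + 1)"
    have "\<phi> k = d - c * (CARD('n) + 1)" if "\<forall>i k. \<phi> i = \<phi> k" for k
    proof -
      have "(\<Sum>i\<in>UNIV. (a i)\<^sup>2 * \<phi> i) = (\<Sum>i\<in>UNIV. (a i)\<^sup>2) * \<phi> k"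
        unfolding sum_distrib_right using that by (intro sum.cong refl) metis
      then show ?thesis using s a_sphere by simp
    qed
    then show ?thesis by metis
  qed
  have "\<phi> i = d - c * (CARD('n) + 1) \<longleftrightarrow>
      a i * d - 1 / (a i) ^ 3 = c * ((CARD('n) + 1) * a i - 1 / a i)" for i
  proof -
    have e: "1 / (a i) ^ 3 = a i * (X i)\<^sup>2" "1 / a i = a i * X i"
      using a_pos[of i] by (simp_all add: X_def power2_eq_square power3_eq_cube)
    have "a i * d - 1 / (a i) ^ 3 - c * ((CARD('n) + 1) * a i - 1 / a i)
        = a i * ((d - c * (CARD('n) + 1)) - \<phi> i)"
      unfolding e \<phi>_def by (simp add: algebra_simps)
    then show ?thesis
      using a_pos[of i] by (metis diff_eq_diff_eq diff_self eq_iff_diff_eq_0 less_irrefl mult_eq_0_iff)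
  qed
  then show ?thesis
    using off const unfolding X_def[symmetric] fac by simp
qed

end

theorem theorem4:
  fixes a :: "'n::finite option \<Rightarrow> real" and n :: nat and d :: real
  assumes n: "n = CARD('n)"
    and a_pos: "\<And>i. a i > 0"
    and a_sphere: "(\<Sum>i\<in>UNIV. (a i)\<^sup>2) = 1"
    and d: "d = (\<Sum>j\<in>UNIV. 1 / (a j)\<^sup>2)"
  shows "biharmonic_submanifold TYPE(real ^ 'n) complex_projective_space (hopf ` torus a) \<longleftrightarrow>
    (\<forall>i. a i * d - 1 / (a i) ^ 3 = 2 * (real n + 3) * ((real n + 1) * a i - 1 / a i))"
proof -
  interpret clifford_torus a
    using a_pos a_sphere by unfold_locales
  show ?thesis
    unfolding biharmonic_torus_iff n d
    using torus_condition_iff[of "2 * (real CARD('n) + 3)"] by (simp add: add.commute)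
qed

end
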